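(* Let $G \subset \mathrm{Diff}^1_+(\mathbb{S}^2)$ be a group containing the rotation group $\mathrm{Rot}(\mathbb{S}^2)=SO(3)$. If $G$ is sharply $3$-transitive, then $G=\mathrm{M\ddot{o}b}(\mathbb{S}^2)$.
   Context: $\mathrm{Diff}^1_+(\mathbb{S}^2)$ denotes the group of orientation-preserving $C^1$ diffeomorphisms of the unit sphere $\mathbb{S}^2\subset\mathbb{R}^3$; $\mathrm{Rot}(\mathbb{S}^2)$ is the group of rotations of $\mathbb{R}^3$ restricted to $\mathbb{S}^2$. $\mathbb{S}^2$ is identified with $\mathbb{C}\cup\{\infty\}$ by stereographic projection; $\mathrm{M\ddot{o}b}(\mathbb{S}^2)$ is the group of maps $z\mapsto (az+b)/(cz+d)$, $ad-bc=1$. A group $G$ of homeomorphisms is $3$-transitive if for any two triples of mutually distinct points $(p_1,p_2,p_3)$, $(q_1,q_2,q_3)$ there is $g\in G$ with $g(p_i)=q_i$; it is sharply $3$-transitive if moreover the only element of $G$ fixing every point of a triple of distinct points is the identity. *)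

theory Defs
  imports "HOL-Analysis.Analysis"
begin

typedef S2 = "{x :: real^3. norm x = 1}"
  by (rule exI[of _ "axis 1 1"]) (simp add: norm_axis_1)

definition C1_on :: "(real^3) set \<Rightarrow> (real^3 \<Rightarrow> real^3) \<Rightarrow> bool" where
  "C1_on S F \<longleftrightarrow> (\<exists>F' :: real^3 \<Rightarrow> ((real^3) \<Rightarrow>\<^sub>L (real^3)).
      (\<forall>x\<in>S. (F has_derivative blinfun_apply (F' x)) (at x)) \<and> continuous_on S F')"

text \<open>Radial (degree one homogeneous) extension of a map of the sphere to R^3 - {0}:
  x \<mapsto> |x| f(x/|x|).  A map f of S^2 is C^1 (as a map of the manifold S^2)
  iff this extension is C^1 on R^3 - {0}.\<close>
definition rad_ext :: "(S2 \<Rightarrow> S2) \<Rightarrow> real^3 \<Rightarrow> real^3" where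
  "rad_ext f x = norm x *\<^sub>R Rep_S2 (f (Abs_S2 (x /\<^sub>R norm x)))"

definition C1_S2 :: "(S2 \<Rightarrow> S2) \<Rightarrow> bool" where
  "C1_S2 f \<longleftrightarrow> C1_on (- {0}) (rad_ext f)"

text \<open>Orientation preserving: the derivative of the radial extension at points of the
  sphere (which maps the outward normal x to the outward normal f x and acts as df on
  tangent vectors) has positive determinant.\<close>
definition orient_pres_S2 :: "(S2 \<Rightarrow> S2) \<Rightarrow> bool" where
  "orient_pres_S2 f \<longleftrightarrow> (\<forall>p. \<exists>D. (rad_ext f has_derivative D) (at (Rep_S2 p)) \<and> det (matrix D) > 0)"

definition Diff1plus :: "(S2 \<Rightarrow> S2) set" where
  "Diff1plus = {f. bij f \<and> C1_S2 f \<and> C1_S2 (inv f) \<and> orient_pres_S2 f}"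

definition Rot :: "(S2 \<Rightarrow> S2) set" where
  "Rot = {(\<lambda>p. Abs_S2 (Q *v Rep_S2 p)) | Q :: real^3^3. rotation_matrix Q}"

text \<open>The Riemann sphere C \<union> {\<infinity>} is modelled as complex option, None = \<infinity>.
  Stereographic projection from the north pole (0,0,1).\<close>
definition stereo :: "real^3 \<Rightarrow> complex option" where
  "stereo x = (if x $ 3 = 1 then None
               else Some (Complex (x $ 1 / (1 - x $ 3)) (x $ 2 / (1 - x $ 3))))"

definition stereo_inv :: "complex option \<Rightarrow> real^3" where
  "stereo_inv w = (case w of None \<Rightarrow> vector [0, 0, 1]
     | Some z \<Rightarrow> vector [2 * Re z / ((cmod z)\<^sup>2 + 1), 2 * Im z / ((cmod z)\<^sup>2 + 1),
                         ((cmod z)\<^sup>2 - 1) / ((cmod z)\<^sup>2 + 1)])"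

definition moeb :: "complex \<Rightarrow> complex \<Rightarrow> complex \<Rightarrow> complex \<Rightarrow> complex option \<Rightarrow> complex option" where
  "moeb a b c d w = (case w of
       None \<Rightarrow> (if c = 0 then None else Some (a / c))
     | Some z \<Rightarrow> (if c * z + d = 0 then None else Some ((a * z + b) / (c * z + d))))"

definition Moeb :: "(S2 \<Rightarrow> S2) set" where
  "Moeb = {(\<lambda>p. Abs_S2 (stereo_inv (moeb a b c d (stereo (Rep_S2 p))))) | a b c d.
              a * d - b * c = 1}"

definition is_group_of_maps :: "('a \<Rightarrow> 'a) set \<Rightarrow> bool" where
  "is_group_of_maps G \<longleftrightarrow> (\<forall>g\<in>G. bij g) \<and> id \<in> G \<and> (\<forall>f\<in>G. \<forall>g\<in>G. f \<circ> g \<in> G)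
      \<and> (\<forall>g\<in>G. inv g \<in> G)"

definition three_transitive :: "('a \<Rightarrow> 'a) set \<Rightarrow> bool" where
  "three_transitive G \<longleftrightarrow> (\<forall>p1 p2 p3 q1 q2 q3.
      p1 \<noteq> p2 \<and> p1 \<noteq> p3 \<and> p2 \<noteq> p3 \<and> q1 \<noteq> q2 \<and> q1 \<noteq> q3 \<and> q2 \<noteq> q3 \<longrightarrow>
      (\<exists>g\<in>G. g p1 = q1 \<and> g p2 = q2 \<and> g p3 = q3))"

definition sharply_three_transitive :: "('a \<Rightarrow> 'a) set \<Rightarrow> bool" where
  "sharply_three_transitive G \<longleftrightarrow> three_transitive G \<and>
     (\<forall>g\<in>G. \<forall>p1 p2 p3. p1 \<noteq> p2 \<and> p1 \<noteq> p3 \<and> p2 \<noteq> p3 \<and>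
        g p1 = p1 \<and> g p2 = p2 \<and> g p3 = p3 \<longrightarrow> g = id)"

end

theory Submission
  imports Defs "HOL-Complex_Analysis.Cauchy_Integral_Formula"
begin

text \<open>
  Let $H$ be the stabilizer in $G$ of the two poles.  If some $h \in H$ preserves the height of a
  single other point, then by sharpness $h$ is a rotation about the vertical axis; so every other
  element of $H$ strictly raises all heights or strictly lowers all of them, and elements of finite
  order in $H$ are rotations.  Applied to $h J h^{-1}$, with $J$ the quarter turn, this shows that
  elements of $H$ are conformal at the poles.

  The Jacobian determinant is multiplicative on the stabilizer of a point, which is generated by
  two-point stabilizers.  If it were trivial on $H$, all of $G$ would preserve area, contradicting
  the strict monotonicity of heights; hence $H$ contains arbitrarily strong dilations at the north
  pole.  If $g \in G$ fixes the north pole but is not conformal there, then the product of $g$ with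
  a rotation and a strong dilation has two distinct real eigenvalues and is a contraction near the
  pole; by Brouwer's theorem it has a second fixed point, so it is conjugate into $H$, which is
  impossible.  Thus $G$ consists of conformal maps.  In the stereographic coordinate those fixing
  infinity are entire of linear growth, hence affine, and together with $1/z$ they generate $G$.
\<close>

unbundle cross3_syntax

section \<open>Points of the sphere and radial extensions\<close>

lemma norm_Rep_S2 [simp]: "norm (Rep_S2 p) = 1"
  using Rep_S2[of p] by simp

lemma Rep_Abs_S2: "norm x = 1 \<Longrightarrow> Rep_S2 (Abs_S2 x) = x"
  by (simp add: Abs_S2_inverse)

lemma Rep_S2_neq_0 [simp]: "Rep_S2 p \<noteq> 0"
  using norm_Rep_S2[of p] by (metis norm_zero zero_neq_one)

lemma Rep_S2_eq_iff: "Rep_S2 p = Rep_S2 q \<longleftrightarrow> p = q"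
  by (simp add: Rep_S2_inject)

lemma vec3_eq_iff: "x = y \<longleftrightarrow> x$1 = y$1 \<and> x$2 = y$2 \<and> x$3 = y$3" for x y :: "'a^3"
  by (simp add: vec_eq_iff forall_3)

lemma norm_eq_1_vec3: "norm x = 1 \<longleftrightarrow> (x$1)\<^sup>2 + (x$2)\<^sup>2 + (x$3)\<^sup>2 = 1" for x :: "real^3"
  by (simp add: norm_eq_sqrt_inner inner_vec_def sum_3 power2_eq_square)

lemma Rep_S2_components: "(Rep_S2 p $ 1)\<^sup>2 + (Rep_S2 p $ 2)\<^sup>2 + (Rep_S2 p $ 3)\<^sup>2 = 1"
  using norm_Rep_S2[of p] norm_eq_1_vec3 by blast

lemma rad_ext_Rep [simp]: "rad_ext g (Rep_S2 p) = Rep_S2 (g p)"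
  by (simp add: rad_ext_def Rep_S2_inverse)

lemma rad_ext_0 [simp]: "rad_ext g 0 = 0"
  by (simp add: rad_ext_def)

lemma norm_rad_ext [simp]: "norm (rad_ext g x) = norm x"
  by (simp add: rad_ext_def)

lemma rad_ext_scaleR:
  assumes "t \<ge> 0" shows "rad_ext g (t *\<^sub>R x) = t *\<^sub>R rad_ext g x"
  using assms by (cases "t = 0") (auto simp: rad_ext_def field_simps)

lemma rad_ext_comp: "rad_ext (f \<circ> g) = rad_ext f \<circ> rad_ext g"
proof
  fix x :: "real^3"
  show "rad_ext (f \<circ> g) x = (rad_ext f \<circ> rad_ext g) x"
  proof (cases "x = 0")
    case False
    have "rad_ext f (rad_ext g x) = norm x *\<^sub>R rad_ext f (Rep_S2 (g (Abs_S2 (x /\<^sub>R norm x))))"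
      by (subst (2) rad_ext_def) (simp add: rad_ext_scaleR del: rad_ext_Rep)
    then show ?thesis by (simp add: rad_ext_def[of "f \<circ> g"])
  qed auto
qed

lemma rad_ext_id: "rad_ext id = id"
proof
  fix x :: "real^3"
  show "rad_ext id x = id x"
    by (cases "x = 0") (auto simp: rad_ext_def Rep_Abs_S2)
qed

section \<open>Rotations acting on the sphere\<close>

definition rot :: "real^3^3 \<Rightarrow> S2 \<Rightarrow> S2" where
  "rot Q p = Abs_S2 (Q *v Rep_S2 p)"

lemma Rot_eq: "Rot = {rot Q | Q. rotation_matrix Q}"
  by (simp add: Rot_def rot_def [abs_def])

lemma norm_rotation_matrix:
  fixes Q :: "real^'n^'n"
  assumes "rotation_matrix Q" shows "norm (Q *v x) = norm x"
  using assms orthogonal_transformation_norm[of "(*v) Q" x]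
  by (simp add: orthogonal_transformation_matrix rotation_matrix_def)

lemma Rep_rot: "rotation_matrix Q \<Longrightarrow> Rep_S2 (rot Q p) = Q *v Rep_S2 p"
  by (simp add: rot_def Rep_Abs_S2 norm_rotation_matrix)

lemma rad_ext_rot:
  assumes "rotation_matrix Q" shows "rad_ext (rot Q) = (*v) Q"
proof
  fix x :: "real^3"
  show "rad_ext (rot Q) x = Q *v x"
    by (cases "x = 0")
       (auto simp: rad_ext_def Rep_rot[OF assms] Rep_Abs_S2 matrix_vector_mult_scaleR)
qed

lemma rot_exists:
  obtains Q where "rotation_matrix Q" "rot Q p = q"
proof -
  obtain f :: "real^3 \<Rightarrow> real^3" where f: "orthogonal_transformation f" "det (matrix f) = 1"
      "f (Rep_S2 p) = Rep_S2 q"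
    using rotation_exists_1[of "Rep_S2 p" "Rep_S2 q"] by auto
  define Q where "Q = matrix f"
  have Q: "rotation_matrix Q" "Q *v Rep_S2 p = Rep_S2 q"
    using f unfolding Q_def orthogonal_transformation_matrix rotation_matrix_def by auto
  then have "rot Q p = q"
    by (simp add: rot_def Rep_S2_inverse)
  with Q show ?thesis using that by blast
qed

section \<open>Derivative matrices of diffeomorphisms of the sphere\<close>

text \<open>This 3x3 matrix stands in for the differential of \<open>g\<close> at \<open>p\<close>:
  it carries the normal \<open>Rep_S2 p\<close> to the normal \<open>Rep_S2 (g p)\<close> and acts
  as the differential on tangent vectors. No tangent bases need to be chosen, and the chain rule
  becomes matrix multiplication.\<close>

definition Dm :: "(S2 \<Rightarrow> S2) \<Rightarrow> S2 \<Rightarrow> real^3^3" where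
  "Dm g p = matrix (frechet_derivative (rad_ext g) (at (Rep_S2 p)))"

lemma Dm_eqI:
  assumes "(rad_ext g has_derivative (\<lambda>v. A *v v)) (at (Rep_S2 p))" shows "Dm g p = A"
  unfolding Dm_def using frechet_derivative_at[OF assms] by (metis matrix_of_matrix_vector_mul)

lemma Diff1plus_differentiable:
  assumes "g \<in> Diff1plus" "x \<noteq> 0" shows "rad_ext g differentiable (at x)"
  using assms unfolding Diff1plus_def C1_S2_def C1_on_def differentiable_def by blast

lemma rad_ext_has_derivative:
  assumes "g \<in> Diff1plus"
  shows "(rad_ext g has_derivative (\<lambda>v. Dm g p *v v)) (at (Rep_S2 p))"
proof -
  have d: "(rad_ext g has_derivative frechet_derivative (rad_ext g) (at (Rep_S2 p))) (at (Rep_S2 p))"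
    using Diff1plus_differentiable[OF assms, of "Rep_S2 p"] frechet_derivative_works Rep_S2_neq_0 by blast
  have "frechet_derivative (rad_ext g) (at (Rep_S2 p)) = (\<lambda>v. Dm g p *v v)"
    unfolding Dm_def using has_derivative_linear[OF d] by (simp add: fun_eq_iff)
  with d show ?thesis by simp
qed

lemma det_Dm_pos:
  assumes "g \<in> Diff1plus" shows "det (Dm g p) > 0"
proof -
  obtain D where D: "(rad_ext g has_derivative D) (at (Rep_S2 p))" "det (matrix D) > 0"
    using assms unfolding Diff1plus_def orient_pres_S2_def by blast
  then show ?thesis unfolding Dm_def using frechet_derivative_at[OF D(1)] by simp
qed

lemma Dm_comp:
  assumes "f \<in> Diff1plus" "g \<in> Diff1plus"
  shows "Dm (f \<circ> g) p = Dm f (g p) ** Dm g p"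
proof (rule Dm_eqI)
  have "(rad_ext f \<circ> rad_ext g has_derivative ((\<lambda>v. Dm f (g p) *v v) \<circ> (\<lambda>v. Dm g p *v v))) (at (Rep_S2 p))"
    using rad_ext_has_derivative[OF assms(1), of "g p"]
    by (intro diff_chain_at rad_ext_has_derivative assms) simp
  then show "(rad_ext (f \<circ> g) has_derivative (\<lambda>v. (Dm f (g p) ** Dm g p) *v v)) (at (Rep_S2 p))"
    unfolding rad_ext_comp by (simp add: o_def matrix_vector_mul_assoc)
qed

lemma Dm_id: "Dm id p = mat 1"
  by (rule Dm_eqI) (unfold rad_ext_id, simp add: id_def)

lemma Dm_rot: "rotation_matrix Q \<Longrightarrow> Dm (rot Q) p = Q"
  by (rule Dm_eqI) (simp add: rad_ext_rot linear_imp_has_derivative)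

lemma continuous_on_rad_ext:
  assumes "g \<in> Diff1plus" shows "continuous_on (-{0}) (rad_ext g)"
  using Diff1plus_differentiable[OF assms]
  by (intro differentiable_imp_continuous_on) (auto simp: differentiable_on_def intro: differentiable_at_withinI)

text \<open>Differentiate along the ray \<open>t *\<^sub>R Rep_S2 p\<close> at \<open>t = 1\<close>
  twice: once by the chain rule, once by homogeneity of the radial extension.\<close>

lemma Dm_radial:
  assumes "g \<in> Diff1plus" shows "Dm g p *v Rep_S2 p = Rep_S2 (g p)"
proof -
  let ?x = "Rep_S2 p"
  have r: "((\<lambda>t::real. t *\<^sub>R ?x) has_derivative (\<lambda>t. t *\<^sub>R ?x)) (at 1)"
    by (intro derivative_eq_intros) auto
  have "(rad_ext g \<circ> (\<lambda>t::real. t *\<^sub>R ?x) has_derivative (\<lambda>v. Dm g p *v v) \<circ> (\<lambda>t. t *\<^sub>R ?x)) (at 1)"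
    by (intro diff_chain_at r) (simp add: rad_ext_has_derivative assms)
  then have 1: "((\<lambda>t. rad_ext g (t *\<^sub>R ?x)) has_derivative (\<lambda>t. t *\<^sub>R (Dm g p *v ?x))) (at 1)"
    by (simp add: o_def matrix_vector_mult_scaleR)
  have "((\<lambda>t::real. t *\<^sub>R Rep_S2 (g p)) has_derivative (\<lambda>t. t *\<^sub>R Rep_S2 (g p))) (at 1)"
    by (intro derivative_eq_intros) auto
  then have 2: "((\<lambda>t. rad_ext g (t *\<^sub>R ?x)) has_derivative (\<lambda>t. t *\<^sub>R Rep_S2 (g p))) (at 1)"
    by (rule has_derivative_transform_within_open[of _ _ _ _ "{0<..}"]) (auto simp: rad_ext_scaleR)
  show ?thesis
    using fun_cong[OF has_derivative_unique[OF 1 2], of 1] by simp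
qed

text \<open>Differentiate the identity
  \<open>rad_ext g x \<bullet> rad_ext g x = x \<bullet> x\<close>. In particular tangent vectors go
  to tangent vectors.\<close>

lemma Dm_tangential:
  assumes "g \<in> Diff1plus" shows "(Dm g p *v v) \<bullet> Rep_S2 (g p) = v \<bullet> Rep_S2 p"
proof -
  let ?x = "Rep_S2 p"
  have "((\<lambda>x. rad_ext g x \<bullet> rad_ext g x) has_derivative
      (\<lambda>v. rad_ext g ?x \<bullet> (Dm g p *v v) + (Dm g p *v v) \<bullet> rad_ext g ?x)) (at ?x)"
    by (intro has_derivative_inner rad_ext_has_derivative assms)
  moreover have "(\<lambda>x. rad_ext g x \<bullet> rad_ext g x) = (\<lambda>x. x \<bullet> x)"
    by (simp add: dot_square_norm)
  moreover have "((\<lambda>x. x \<bullet> x) has_derivative (\<lambda>v. ?x \<bullet> v + v \<bullet> ?x)) (at ?x)"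
    by (intro has_derivative_inner has_derivative_ident)
  ultimately have "(\<lambda>v. rad_ext g ?x \<bullet> (Dm g p *v v) + (Dm g p *v v) \<bullet> rad_ext g ?x) = (\<lambda>v. ?x \<bullet> v + v \<bullet> ?x)"
    by (simp add: has_derivative_unique)
  then have "rad_ext g ?x \<bullet> (Dm g p *v v) + (Dm g p *v v) \<bullet> rad_ext g ?x = ?x \<bullet> v + v \<bullet> ?x"
    by meson
  then show ?thesis by (simp add: inner_commute)
qed

section \<open>Auxiliary points, poles and heights\<close>

lemma infinite_UNIV_S2: "infinite (UNIV :: S2 set)"
proof -
  have "inj_on (\<lambda>t::real. Abs_S2 (vector [t, sqrt (1 - t\<^sup>2), 0])) {0..1}"
  proof (rule inj_onI)
    fix s t :: real
    assume st: "s \<in> {0..1}" "t \<in> {0..1}"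
      "Abs_S2 (vector [s, sqrt (1 - s\<^sup>2), 0]) = Abs_S2 (vector [t, sqrt (1 - t\<^sup>2), 0])"
    have "norm (vector [u, sqrt (1 - u\<^sup>2), 0] :: real^3) = 1" if "u \<in> {0..1}" for u :: real
      using that by (simp add: norm_eq_1_vec3 abs_square_le_1)
    then have "(vector [s, sqrt (1 - s\<^sup>2), 0] :: real^3) = vector [t, sqrt (1 - t\<^sup>2), 0]"
      using st Abs_S2_inject by simp
    then show "s = t" by (simp add: vec3_eq_iff)
  qed
  moreover have "infinite {0..1::real}" by (simp add: infinite_Icc)
  ultimately have "infinite ((\<lambda>t::real. Abs_S2 (vector [t, sqrt (1 - t\<^sup>2), 0])) ` {0..1})"
    by (simp add: finite_image_iff)
  then show ?thesis by (rule infinite_super[OF subset_UNIV])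
qed

lemma S2_avoid_finite:
  assumes "finite A" obtains p :: S2 where "p \<notin> A"
  using infinite_UNIV_S2 assms by (metis ex_new_if_finite)

definition NP :: S2 where "NP = Abs_S2 (axis 3 1)"

definition SP :: S2 where "SP = Abs_S2 (- axis 3 1)"

definition EP :: S2 where "EP = Abs_S2 (axis 1 1)"

lemma Rep_NP: "Rep_S2 NP = axis 3 1" and Rep_SP: "Rep_S2 SP = - axis 3 1"
  and Rep_EP: "Rep_S2 EP = axis 1 1"
  by (simp_all add: NP_def SP_def EP_def Rep_Abs_S2 norm_axis_1)

lemma Rep_poles [simp]:
  "Rep_S2 NP $ 1 = 0" "Rep_S2 NP $ 2 = 0" "Rep_S2 NP $ 3 = 1"
  "Rep_S2 SP $ 1 = 0" "Rep_S2 SP $ 2 = 0" "Rep_S2 SP $ 3 = -1"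
  "Rep_S2 EP $ 1 = 1" "Rep_S2 EP $ 2 = 0" "Rep_S2 EP $ 3 = 0"
  by (simp_all add: Rep_NP Rep_SP Rep_EP axis_def)

lemma poles_distinct [simp]:
  "NP \<noteq> SP" "SP \<noteq> NP" "EP \<noteq> NP" "EP \<noteq> SP" "NP \<noteq> EP" "SP \<noteq> EP"
  using Rep_poles by (metis one_neq_neg_one zero_neq_one zero_neq_neg_one)+

abbreviation ht :: "S2 \<Rightarrow> real" where "ht p \<equiv> Rep_S2 p $ 3"

lemma ht_eq_1_iff: "ht p = 1 \<longleftrightarrow> p = NP"
proof
  assume "ht p = 1"
  moreover have "(Rep_S2 p $ 1)\<^sup>2 + (Rep_S2 p $ 2)\<^sup>2 + (ht p)\<^sup>2 = 1" by (rule Rep_S2_components)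
  ultimately have "Rep_S2 p = Rep_S2 NP" by (simp add: vec3_eq_iff sum_power2_eq_zero_iff)
  then show "p = NP" by (simp add: Rep_S2_eq_iff)
qed simp

lemma ht_eq_minus_1_iff: "ht p = -1 \<longleftrightarrow> p = SP"
proof
  assume "ht p = -1"
  moreover have "(Rep_S2 p $ 1)\<^sup>2 + (Rep_S2 p $ 2)\<^sup>2 + (ht p)\<^sup>2 = 1" by (rule Rep_S2_components)
  ultimately have "Rep_S2 p = Rep_S2 SP" by (simp add: vec3_eq_iff sum_power2_eq_zero_iff)
  then show "p = SP" by (simp add: Rep_S2_eq_iff)
qed simp

text \<open>Chordal distance to the north pole is a decreasing function of height, so derivative
  estimates at the pole become statements about heights.\<close>

lemma norm_diff_NP: "(norm (Rep_S2 p - Rep_S2 NP))\<^sup>2 = 2 * (1 - ht p)"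
proof -
  have "(norm (Rep_S2 p - Rep_S2 NP))\<^sup>2 = (Rep_S2 p $ 1)\<^sup>2 + (Rep_S2 p $ 2)\<^sup>2 + (ht p - 1)\<^sup>2"
    by (simp add: power2_norm_eq_inner inner_vec_def sum_3) (simp add: power2_eq_square)
  then show ?thesis using Rep_S2_components[of p] by (simp add: power2_eq_square algebra_simps)
qed

section \<open>Stereographic coordinates\<close>

definition chart :: "real^3 \<Rightarrow> complex" where
  "chart x = Complex (x$1 / (1 - x$3)) (x$2 / (1 - x$3))"

definition unchart :: "complex \<Rightarrow> real^3" where
  "unchart z = stereo_inv (Some z)"

lemma stereo_eq: "stereo x = (if x$3 = 1 then None else Some (chart x))"
  by (simp add: stereo_def chart_def)

lemma unchart_components:
  "unchart z $ 1 = 2 * Re z / ((Re z)\<^sup>2 + (Im z)\<^sup>2 + 1)"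
  "unchart z $ 2 = 2 * Im z / ((Re z)\<^sup>2 + (Im z)\<^sup>2 + 1)"
  "unchart z $ 3 = ((Re z)\<^sup>2 + (Im z)\<^sup>2 - 1) / ((Re z)\<^sup>2 + (Im z)\<^sup>2 + 1)"
  by (simp_all add: unchart_def stereo_inv_def cmod_power2)

lemma sum_squares_plus_1_neq_0 [simp]: "a\<^sup>2 + b\<^sup>2 + 1 \<noteq> (0::real)"
  by (smt (verit) zero_le_power2)

lemma norm_unchart [simp]: "norm (unchart z) = 1"
proof -
  have "(2 * Re z)\<^sup>2 + (2 * Im z)\<^sup>2 + ((Re z)\<^sup>2 + (Im z)\<^sup>2 - 1)\<^sup>2 = ((Re z)\<^sup>2 + (Im z)\<^sup>2 + 1)\<^sup>2"
    by algebra
  then show ?thesis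
    by (simp add: norm_eq_1_vec3 unchart_components power_divide add_divide_distrib[symmetric])
qed

lemma unchart_neq_0 [simp]: "unchart z \<noteq> 0"
  using norm_unchart[of z] by (metis norm_zero zero_neq_one)

lemma one_minus_unchart_3: "1 - unchart z $ 3 = 2 / ((Re z)\<^sup>2 + (Im z)\<^sup>2 + 1)"
  using sum_squares_plus_1_neq_0[of "Re z" "Im z"]
  by (simp add: unchart_components diff_divide_eq_iff divide_simps)

lemma unchart_3_neq_1 [simp]: "unchart z $ 3 \<noteq> 1"
  using one_minus_unchart_3[of z] sum_squares_plus_1_neq_0[of "Re z" "Im z"] by force

lemma chart_unchart [simp]: "chart (unchart z) = z"
  unfolding chart_def one_minus_unchart_3
  by (simp add: unchart_components complex_eq_iff)

lemma unchart_chart: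
  assumes "norm x = 1" "x$3 \<noteq> 1" shows "unchart (chart x) = x"
proof -
  have n: "(x$1)\<^sup>2 + (x$2)\<^sup>2 = (1 - x$3) * (1 + x$3)"
    using assms(1) by (simp add: norm_eq_1_vec3 power2_eq_square algebra_simps)
  define d where "d = 1 - x$3"
  have d: "d \<noteq> 0" "x$3 = 1 - d" using assms(2) by (auto simp: d_def)
  have "(x$1 / d)\<^sup>2 + (x$2 / d)\<^sup>2 = (2 - d) / d"
    using n d by (simp add: power_divide add_divide_distrib[symmetric] power2_eq_square)
  then show ?thesis
    using d
    by (simp add: vec3_eq_iff unchart_components chart_def) (simp add: field_simps)
qed

lemma continuous_on_unchart: "continuous_on A unchart"
proof -
  have "continuous_on A (\<lambda>z. \<chi> i. unchart z $ i)"
  proof (rule continuous_on_vec_lambda)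
    fix i :: 3
    have "\<forall>i. continuous_on A (\<lambda>z. unchart z $ i)"
      unfolding forall_3 unchart_components by (intro conjI continuous_intros) auto
    then show "continuous_on A (\<lambda>z. unchart z $ i)" by blast
  qed
  then show ?thesis by simp
qed

lemma continuous_on_chart: "continuous_on {x. x$3 \<noteq> 1} chart"
  unfolding chart_def Complex_eq by (intro continuous_intros) auto

text \<open>The inverse stereographic projection exhibits this set as a continuous image of the
  punctured plane, the south pole corresponding to \<open>0\<close>.\<close>

lemma connected_sphere_minus_poles: "connected {x :: real^3. norm x = 1 \<and> x$3 \<noteq> 1 \<and> x$3 \<noteq> -1}"
proof -
  have "connected (unchart ` (- {0}))"
    by (intro connected_continuous_image continuous_on_unchart connected_punctured_universe) simp
  also have "unchart ` (- {0}) = {x. norm x = 1 \<and> x$3 \<noteq> 1 \<and> x$3 \<noteq> -1}"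
  proof safe
    fix z assume "z \<noteq> 0" "unchart z $ 3 = - 1"
    then have "2 / ((Re z)\<^sup>2 + (Im z)\<^sup>2 + 1) = 2" using one_minus_unchart_3[of z] by simp
    then have "2 = 2 * ((Re z)\<^sup>2 + (Im z)\<^sup>2 + 1)"
      using sum_squares_plus_1_neq_0[of "Re z" "Im z"] by (simp only: divide_eq_eq if_True not_False_eq_True)
    then have "(Re z)\<^sup>2 + (Im z)\<^sup>2 = 0" by algebra
    then have "Re z = 0 \<and> Im z = 0" using sum_power2_eq_zero_iff by blast
    then show False using \<open>z \<noteq> 0\<close> by (simp add: complex_eq_iff)
  next
    fix x :: "real^3" assume x: "norm x = 1" "x$3 \<noteq> 1" "x$3 \<noteq> -1"
    have "chart x \<noteq> 0"
    proof
      assume "chart x = 0"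
      then have "x = unchart 0" using unchart_chart x by metis
      then show False using x by (simp add: unchart_components)
    qed
    then show "x \<in> unchart ` (- {0})"
      using unchart_chart[OF x(1,2)] by (intro image_eqI[of _ _ "chart x"]) auto
  qed auto
  finally show ?thesis .
qed

section \<open>Rotations about the vertical axis\<close>

definition rz :: "real \<Rightarrow> real \<Rightarrow> real^3^3" where
  "rz c s = vector [vector [c, -s, 0], vector [s, c, 0], vector [0, 0, 1]]"

lemma rz_components [simp]:
  "rz c s $ 1 $ 1 = c" "rz c s $ 1 $ 2 = -s" "rz c s $ 1 $ 3 = 0"
  "rz c s $ 2 $ 1 = s" "rz c s $ 2 $ 2 = c" "rz c s $ 2 $ 3 = 0"
  "rz c s $ 3 $ 1 = 0" "rz c s $ 3 $ 2 = 0" "rz c s $ 3 $ 3 = 1"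
  by (simp_all add: rz_def)

lemma mat3_eq_iff: "A = B \<longleftrightarrow>
   A$1$1 = B$1$1 \<and> A$1$2 = B$1$2 \<and> A$1$3 = B$1$3 \<and>
   A$2$1 = B$2$1 \<and> A$2$2 = B$2$2 \<and> A$2$3 = B$2$3 \<and>
   A$3$1 = B$3$1 \<and> A$3$2 = B$3$2 \<and> A$3$3 = B$3$3" for A B :: "'a^3^3"
  by (simp add: vec3_eq_iff conj_assoc)

lemma mat3_mult_components: "(A ** B) $ i $ j = A$i$1 * B$1$j + A$i$2 * B$2$j + A$i$3 * B$3$j"
  for A B :: "real^3^3"
  by (simp add: matrix_matrix_mult_def sum_3)

lemma mat3_vec_components: "(A *v x) $ i = A$i$1 * x$1 + A$i$2 * x$2 + A$i$3 * x$3"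
  for A :: "real^3^3"
  by (simp add: matrix_vector_mult_def sum_3)

lemma mat_1_components: "(mat 1 :: real^3^3) $ i $ j = (if i = j then 1 else 0)"
  by (simp add: mat_def)

lemma rotation_rz:
  assumes "c\<^sup>2 + s\<^sup>2 = 1" shows "rotation_matrix (rz c s)"
proof -
  have "transpose (rz c s) ** rz c s = mat 1"
    using assms
    by (simp add: mat3_eq_iff mat3_mult_components mat_1_components transpose_def power2_eq_square algebra_simps)
  moreover have "det (rz c s) = 1"
    using assms by (simp add: det_3 power2_eq_square)
  ultimately show ?thesis
    unfolding rotation_matrix_def orthogonal_matrix by simp
qed

lemma rot_rz_poles [simp]:
  assumes "c\<^sup>2 + s\<^sup>2 = 1" shows "rot (rz c s) NP = NP" "rot (rz c s) SP = SP"
proof -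
  have "Rep_S2 (rot (rz c s) NP) = Rep_S2 NP" "Rep_S2 (rot (rz c s) SP) = Rep_S2 SP"
    by (simp_all add: Rep_rot[OF rotation_rz[OF assms]] vec3_eq_iff mat3_vec_components)
  then show "rot (rz c s) NP = NP" "rot (rz c s) SP = SP" by (simp_all add: Rep_S2_eq_iff)
qed

lemma rz_transitive_on_parallels:
  assumes "ht p = ht q" "p \<noteq> NP" "p \<noteq> SP"
  obtains c s where "c\<^sup>2 + s\<^sup>2 = 1" "rot (rz c s) p = q"
proof -
  define x y where "x = Rep_S2 p" and "y = Rep_S2 q"
  define r where "r = (x$1)\<^sup>2 + (x$2)\<^sup>2"
  have x: "(x$1)\<^sup>2 + (x$2)\<^sup>2 + (x$3)\<^sup>2 = 1" "(y$1)\<^sup>2 + (y$2)\<^sup>2 + (y$3)\<^sup>2 = 1" "x$3 = y$3"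
    using assms(1) Rep_S2_components[of p] Rep_S2_components[of q] unfolding x_def y_def by blast+
  then have r: "r = (y$1)\<^sup>2 + (y$2)\<^sup>2" by (simp add: r_def)
  have "(x$3)\<^sup>2 \<noteq> 1"
    using assms ht_eq_1_iff[of p] ht_eq_minus_1_iff[of p] by (simp add: x_def power2_eq_1_iff)
  then have r0: "r \<noteq> 0" using x(1) by (auto simp: r_def)
  \<comment> \<open>With the horizontal parts of \<open>x\<close> and \<open>y\<close> read as
    complex numbers of equal modulus, \<open>c + \<i> s\<close> is their quotient
    \<open>y / x\<close>; \<open>r\<close> is nonzero because \<open>p\<close> is not a
    pole.\<close>
  define c s where "c = (x$1 * y$1 + x$2 * y$2) / r" and "s = (x$1 * y$2 - x$2 * y$1) / r"
  have "(x$1 * y$1 + x$2 * y$2)\<^sup>2 + (x$1 * y$2 - x$2 * y$1)\<^sup>2 = r * r"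
    by (subst (1) r_def, subst r) algebra
  then have cs: "c\<^sup>2 + s\<^sup>2 = 1"
    using r0 by (simp add: c_def s_def power_divide add_divide_distrib[symmetric] power2_eq_square)
  have "(x$1 * y$1 + x$2 * y$2) * x$1 - (x$1 * y$2 - x$2 * y$1) * x$2 = y$1 * r"
    "(x$1 * y$2 - x$2 * y$1) * x$1 + (x$1 * y$1 + x$2 * y$2) * x$2 = y$2 * r"
    unfolding r_def by algebra+
  then have "c * x$1 - s * x$2 = y$1" "s * x$1 + c * x$2 = y$2"
    using r0 unfolding c_def s_def times_divide_eq_left diff_divide_distrib[symmetric]
      add_divide_distrib[symmetric] by simp_all
  then have "Rep_S2 (rot (rz c s) p) = Rep_S2 q"
    using x(3) by (simp add: Rep_rot rotation_rz cs vec3_eq_iff mat3_vec_components x_def[symmetric] y_def[symmetric])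
  then show ?thesis using that cs by (simp add: Rep_S2_eq_iff)
qed

section \<open>Stabilizers of two points\<close>

text \<open>At a fixed pole the matrix splits into a horizontal 2x2 block and the entry 1: the third
  column comes from \<open>Dm_radial\<close>, the third row from \<open>Dm_tangential\<close>. All
  later conditions concern the 2x2 block.\<close>

lemma Dm_NP_block:
  assumes "g \<in> Diff1plus" "g NP = NP"
  shows "Dm g NP $ 1 $ 3 = 0" "Dm g NP $ 2 $ 3 = 0" "Dm g NP $ 3 $ 3 = 1"
    "Dm g NP $ 3 $ 1 = 0" "Dm g NP $ 3 $ 2 = 0"
proof -
  have c: "Dm g NP *v Rep_S2 NP = Rep_S2 NP"
    using Dm_radial[OF assms(1), of NP] assms(2) by simp
  then show "Dm g NP $ 1 $ 3 = 0" "Dm g NP $ 2 $ 3 = 0" "Dm g NP $ 3 $ 3 = 1"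
    by (simp_all add: vec3_eq_iff mat3_vec_components)
  have "(Dm g NP *v v) $ 3 = v $ 3" for v
    using Dm_tangential[OF assms(1), of NP v] assms(2) by (simp add: inner_vec_def sum_3)
  from this[of "axis 1 1"] this[of "axis 2 1"]
  show "Dm g NP $ 3 $ 1 = 0" "Dm g NP $ 3 $ 2 = 0"
    by (simp_all add: mat3_vec_components axis_def)
qed

lemma det_Dm_NP:
  assumes "g \<in> Diff1plus" "g NP = NP"
  shows "det (Dm g NP) = Dm g NP $ 1 $ 1 * Dm g NP $ 2 $ 2 - Dm g NP $ 1 $ 2 * Dm g NP $ 2 $ 1"
  by (simp add: det_3 Dm_NP_block[OF assms])

locale sharply_3_transitive_diff_group =
  fixes G :: "(S2 \<Rightarrow> S2) set"
  assumes group: "is_group_of_maps G"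
    and diff: "G \<subseteq> Diff1plus"
    and Rot_sub: "Rot \<subseteq> G"
    and sharp: "sharply_three_transitive G"
begin

lemma in_Diff [simp]: "g \<in> G \<Longrightarrow> g \<in> Diff1plus"
  using diff by blast

lemma bij [simp]: "g \<in> G \<Longrightarrow> bij g"
  using group unfolding is_group_of_maps_def by blast

lemma comp_in [simp, intro]: "f \<in> G \<Longrightarrow> g \<in> G \<Longrightarrow> f \<circ> g \<in> G"
  using group unfolding is_group_of_maps_def by blast

lemma inv_in [simp, intro]: "g \<in> G \<Longrightarrow> inv g \<in> G"
  using group unfolding is_group_of_maps_def by blast

lemma id_in: "id \<in> G"
  using group unfolding is_group_of_maps_def by blast

lemma rot_in [simp, intro]: "rotation_matrix Q \<Longrightarrow> rot Q \<in> G"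
  using Rot_sub unfolding Rot_eq by blast

lemma inv_apply [simp]: "g \<in> G \<Longrightarrow> inv g (g p) = p" "g \<in> G \<Longrightarrow> g (inv g p) = p"
  by (simp_all add: bij_is_inj bij_is_surj surj_f_inv_f)

lemma inv_comp: "g \<in> G \<Longrightarrow> inv g \<circ> g = id" "g \<in> G \<Longrightarrow> g \<circ> inv g = id"
  by (simp_all add: fun_eq_iff)

lemma apply_eq_iff: "g \<in> G \<Longrightarrow> g p = g q \<longleftrightarrow> p = q"
  using bij bij_is_inj inj_eq by metis

lemma inv_fixes: "g \<in> G \<Longrightarrow> g p = q \<Longrightarrow> inv g q = p"
  by auto

text \<open>Sharpness applied to \<open>inv g \<circ> f\<close>, which fixes the three
  points.\<close>

lemma eq_if_agree_at_3:
  assumes "f \<in> G" "g \<in> G" "p \<noteq> q" "p \<noteq> r" "q \<noteq> r" "f p = g p" "f q = g q" "f r = g r"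
  shows "f = g"
proof -
  have "inv g \<circ> f \<in> G" "(inv g \<circ> f) p = p" "(inv g \<circ> f) q = q" "(inv g \<circ> f) r = r"
    using assms by auto
  then have "inv g \<circ> f = id"
    using sharp assms(3-5) unfolding sharply_three_transitive_def by blast
  then have "inv g (f x) = x" for x by (simp add: fun_eq_iff)
  then have "f x = g x" for x
    using inv_apply(2)[OF assms(2), of "f x"] by simp
  then show ?thesis ..
qed

lemma transitive_3:
  assumes "p1 \<noteq> p2" "p1 \<noteq> p3" "p2 \<noteq> p3" "q1 \<noteq> q2" "q1 \<noteq> q3" "q2 \<noteq> q3"
  obtains g where "g \<in> G" "g p1 = q1" "g p2 = q2" "g p3 = q3"
  using sharp assms unfolding sharply_three_transitive_def three_transitive_def by blast

text \<open>Each of the pairs \<open>x, p\<close> and \<open>x, q\<close> is completed to a triple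
  by an arbitrary further point.\<close>

lemma stabilizer_transitive:
  assumes "x \<noteq> p" "x \<noteq> q"
  obtains g where "g \<in> G" "g x = x" "g p = q"
proof -
  obtain p' where "p' \<notin> {x, p}" using S2_avoid_finite[of "{x,p}"] by blast
  moreover obtain q' where "q' \<notin> {x, q}" using S2_avoid_finite[of "{x,q}"] by blast
  ultimately show ?thesis
    by - (rule transitive_3[of x p p' x q q'], use assms that in auto)
qed

lemma Dm_comp_in: "f \<in> G \<Longrightarrow> g \<in> G \<Longrightarrow> Dm (f \<circ> g) p = Dm f (g p) ** Dm g p"
  by (simp add: Dm_comp)

text \<open>If the height of one non-polar point is kept, a rotation about the axis agrees with
  \<open>h\<close> there and at both poles, so sharpness identifies the two. Otherwise the change of
  height is continuous and never zero on a connected set, hence has constant sign.\<close>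

lemma height_trichotomy:
  assumes h: "h \<in> G" "h NP = NP" "h SP = SP"
  obtains (rotation) c s where "c\<^sup>2 + s\<^sup>2 = 1" "h = rot (rz c s)"
  | (up) "\<And>p. p \<noteq> NP \<Longrightarrow> p \<noteq> SP \<Longrightarrow> ht (h p) > ht p"
  | (down) "\<And>p. p \<noteq> NP \<Longrightarrow> p \<noteq> SP \<Longrightarrow> ht (h p) < ht p"
proof (cases "\<exists>p. p \<noteq> NP \<and> p \<noteq> SP \<and> ht (h p) = ht p")
  case True
  then obtain p where p: "p \<noteq> NP" "p \<noteq> SP" "ht p = ht (h p)" by auto
  then obtain c s where cs: "c\<^sup>2 + s\<^sup>2 = 1" "rot (rz c s) p = h p"
    using rz_transitive_on_parallels[of p "h p"] by blast
  have "h = rot (rz c s)"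
    using cs p h by (intro eq_if_agree_at_3[of _ _ NP SP p]) (auto simp: rotation_rz)
  then show ?thesis using rotation cs(1) by blast
next
  case False
  \<comment> \<open>The type \<open>S2\<close> carries no topology here, so the sign argument runs
    on the representing vectors in \<open>real^3\<close>.\<close>
  define X where "X = {x :: real^3. norm x = 1 \<and> x$3 \<noteq> 1 \<and> x$3 \<noteq> -1}"
  define u where "u x = rad_ext h x $ 3 - x $ 3" for x
  have X: "p \<noteq> NP \<and> p \<noteq> SP \<longleftrightarrow> Rep_S2 p \<in> X" for p
    by (simp add: X_def ht_eq_1_iff ht_eq_minus_1_iff)
  have "continuous_on X u"
    unfolding u_def
    by (intro continuous_intros continuous_on_subset[OF continuous_on_rad_ext])
       (use h in \<open>auto simp: X_def\<close>)
  then have "connected (u ` X)"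
    using connected_continuous_image connected_sphere_minus_poles X_def by blast
  then have iv: "is_interval (u ` X)" by (simp add: is_interval_connected_1)
  have "u x \<noteq> 0" if "x \<in> X" for x
    using False that X[of "Abs_S2 x"] rad_ext_Rep[of h "Abs_S2 x"]
    by (auto simp: u_def X_def Rep_Abs_S2)
  then have n0: "0 \<notin> u ` X" by auto
  have "(\<forall>x\<in>X. u x > 0) \<or> (\<forall>x\<in>X. u x < 0)"
  proof (rule ccontr)
    assume "\<not> ?thesis"
    then obtain x y where "x \<in> X" "y \<in> X" "u x \<le> 0" "0 \<le> u y" by force
    then have "0 \<in> u ` X"
      using iv[unfolded is_interval_1, rule_format, of "u x" "u y" 0] by simp
    then show False using n0 by blast
  qed
  then show ?thesis
  proof
    assume u: "\<forall>x\<in>X. u x > 0"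
    have "ht (h p) > ht p" if "p \<noteq> NP" "p \<noteq> SP" for p
      using bspec[OF u, of "Rep_S2 p"] X[of p] that by (simp add: u_def)
    then show ?thesis by (rule up)
  next
    assume u: "\<forall>x\<in>X. u x < 0"
    have "ht (h p) < ht p" if "p \<noteq> NP" "p \<noteq> SP" for p
      using bspec[OF u, of "Rep_S2 p"] X[of p] that by (simp add: u_def)
    then show ?thesis by (rule down)
  qed
qed

text \<open>In the monotone cases heights move strictly in one direction along an orbit, so no
  non-polar point can return after four steps.\<close>

lemma order_4_imp_rotation:
  assumes k: "k \<in> G" "k NP = NP" "k SP = SP" and k4: "\<And>p. k (k (k (k p))) = p"
  obtains c s where "c\<^sup>2 + s\<^sup>2 = 1" "k = rot (rz c s)"
  using k
proof (cases rule: height_trichotomy)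
  case up
  have np: "k p \<noteq> NP \<and> k p \<noteq> SP" if "p \<noteq> NP" "p \<noteq> SP" for p
    using that k apply_eq_iff[of k p NP] apply_eq_iff[of k p SP] by simp
  have "ht (k (k (k (k EP)))) > ht EP"
    using up[of EP] up[of "k EP"] up[of "k (k EP)"] up[of "k (k (k EP))"] np by simp
  then show ?thesis using k4 by simp
next
  case down
  have np: "k p \<noteq> NP \<and> k p \<noteq> SP" if "p \<noteq> NP" "p \<noteq> SP" for p
    using that k apply_eq_iff[of k p NP] apply_eq_iff[of k p SP] by simp
  have "ht (k (k (k (k EP)))) < ht EP"
    using down[of EP] down[of "k EP"] down[of "k (k EP)"] down[of "k (k (k EP))"] np by simp
  then show ?thesis using k4 by simp
qed (use that in blast)

text \<open>The conjugate \<open>k\<close> of the quarter turn \<open>J\<close> by \<open>h\<close>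
  has fourth power the identity and fixes the poles, so it is a rotation. Hence the derivative of
  \<open>h\<close> intertwines the quarter turn with a rotation; that rotation must be a quarter
  turn, and positivity of the determinant fixes its sense.\<close>

lemma conformal_at_pole:
  assumes h: "h \<in> G" "h NP = NP" "h SP = SP"
  shows "Dm h NP $ 1 $ 1 = Dm h NP $ 2 $ 2" "Dm h NP $ 1 $ 2 = - Dm h NP $ 2 $ 1"
proof -
  define J where "J = rot (rz 0 1)"
  have rJ: "rotation_matrix (rz 0 1)" by (simp add: rotation_rz)
  have JG: "J \<in> G" using rJ by (simp add: J_def)
  have JJ: "J (J (J (J p))) = p" for p
  proof -
    have "Rep_S2 (J (J (J (J p)))) = Rep_S2 p"
      by (simp add: J_def Rep_rot rJ vec3_eq_iff mat3_vec_components)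
    then show ?thesis by (simp add: Rep_S2_eq_iff)
  qed
  define k where "k = h \<circ> J \<circ> inv h"
  have kG: "k \<in> G" using h JG by (auto simp: k_def)
  have "inv h NP = NP" "inv h SP = SP" using h by (auto intro: inv_fixes)
  then have kp: "k NP = NP" "k SP = SP" using h by (auto simp: k_def J_def)
  have "k (k (k (k p))) = p" for p
    using h JG JJ by (simp add: k_def)
  then obtain x y where xy: "x\<^sup>2 + y\<^sup>2 = 1" "k = rot (rz x y)"
    using order_4_imp_rotation[OF kG kp] by blast
  have "k \<circ> h = h \<circ> J" using h by (auto simp: k_def fun_eq_iff)
  then have "Dm k (h NP) ** Dm h NP = Dm h (J NP) ** Dm J NP"
    using Dm_comp_in[OF kG h(1), of NP] Dm_comp_in[OF h(1) JG, of NP] by simp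
  then have eq: "rz x y ** Dm h NP = Dm h NP ** rz 0 1"
    using h xy by (simp add: J_def Dm_rot rotation_rz)
  define a b c d where "a = Dm h NP $ 1 $ 1" and "b = Dm h NP $ 1 $ 2"
    and "c = Dm h NP $ 2 $ 1" and "d = Dm h NP $ 2 $ 2"
  have e: "x * a - y * c = b" "x * b - y * d = - a" "y * a + x * c = d" "y * b + x * d = - c"
    using eq by (simp_all add: mat3_eq_iff mat3_mult_components a_def b_def c_def d_def)
  have det: "a * d - b * c > 0"
    using det_Dm_pos[of h NP] det_Dm_NP[of h] h by (simp add: a_def b_def c_def d_def)
  \<comment> \<open>Let \<open>R\<close> be the horizontal rotation and \<open>M\<close> the block
    of \<open>h\<close>. Then \<open>R\<^sup>2 M = - M\<close>, while Cayley-Hamilton gives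
    \<open>R\<^sup>2 + 1 = 2 x R\<close>, so \<open>2 x R M = 0\<close>. Two entries of this say
    that \<open>x\<close> annihilates the second column of \<open>M\<close>, whose determinant is
    nonzero.\<close>
  have "x * (b + (x * a - y * c)) = 0" using e(2,3) xy(1) by algebra
  then have "x * b = 0" using e(1) by simp
  moreover have "x * (d + (y * a + x * c)) = (y * b + x * d + c) + y * (x * a - y * c - b) + c * (x\<^sup>2 + y\<^sup>2 - 1)"
    by (simp add: algebra_simps power2_eq_square)
  then have "x * (d + (y * a + x * c)) = 0" using e(1,4) xy(1) by simp
  then have "x * d = 0" using e(3) by simp
  ultimately have "x = 0" using det by auto
  then consider "y = 1" | "y = -1" using xy(1) by (auto simp: power2_eq_1_iff)
  then have "a = d \<and> b = - c"
  proof cases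
    case 2
    then have "a * d - b * c = - (a\<^sup>2 + c\<^sup>2)"
      using e \<open>x = 0\<close> by (simp add: power2_eq_square algebra_simps)
    then show ?thesis using det by (smt (verit) zero_le_power2)
  qed (use e \<open>x = 0\<close> in auto)
  then show "Dm h NP $ 1 $ 1 = Dm h NP $ 2 $ 2" "Dm h NP $ 1 $ 2 = - Dm h NP $ 2 $ 1"
    by (simp_all add: a_def b_def c_def d_def)
qed

end

section \<open>Volume preservation and the existence of dilations\<close>

text \<open>The derivative of a map homogeneous of degree one is constant along rays. This extends
  \<open>Dm\<close> from the sphere to open sets of \<open>real^3\<close>, where volumes are
  compared.\<close>

lemma rad_ext_has_derivative_at:
  assumes g: "g \<in> Diff1plus" and x: "x \<noteq> 0"
  shows "(rad_ext g has_derivative (\<lambda>v. Dm g (Abs_S2 (x /\<^sub>R norm x)) *v v)) (at x)"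
proof -
  define t where "t = norm x"
  define p where "p = Abs_S2 (x /\<^sub>R t)"
  have t: "t > 0" using x by (simp add: t_def)
  have p: "Rep_S2 p = x /\<^sub>R t" using x by (simp add: p_def t_def Rep_Abs_S2)
  have "((\<lambda>y. y /\<^sub>R t) has_derivative (\<lambda>v. v /\<^sub>R t)) (at x)"
    by (intro derivative_eq_intros) auto
  then have "(rad_ext g \<circ> (\<lambda>y. y /\<^sub>R t) has_derivative (\<lambda>v. Dm g p *v v) \<circ> (\<lambda>v. v /\<^sub>R t)) (at x)"
    by (rule diff_chain_at) (use rad_ext_has_derivative[OF g, of p] p in simp)
  then have "((\<lambda>y. t *\<^sub>R (rad_ext g \<circ> (\<lambda>y. y /\<^sub>R t)) y) has_derivative
      (\<lambda>v. t *\<^sub>R ((\<lambda>v. Dm g p *v v) \<circ> (\<lambda>v. v /\<^sub>R t)) v)) (at x)"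
    by (rule has_derivative_scaleR_right)
  moreover have "(\<lambda>y. t *\<^sub>R (rad_ext g \<circ> (\<lambda>y. y /\<^sub>R t)) y) = rad_ext g"
    using t by (simp add: fun_eq_iff rad_ext_scaleR)
  moreover have "(\<lambda>v. t *\<^sub>R ((\<lambda>v. Dm g p *v v) \<circ> (\<lambda>v. v /\<^sub>R t)) v) = (\<lambda>v. Dm g p *v v)"
    using t by (simp add: fun_eq_iff matrix_vector_mult_scaleR)
  ultimately show ?thesis by (simp add: p_def t_def)
qed

context sharply_3_transitive_diff_group
begin

lemma rad_ext_inv: "g \<in> G \<Longrightarrow> rad_ext (inv g) (rad_ext g x) = x" "g \<in> G \<Longrightarrow> rad_ext g (rad_ext (inv g) x) = x"
  using rad_ext_comp[of "inv g" g] rad_ext_comp[of g "inv g"] inv_comp[of g]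
  by (auto simp: rad_ext_id fun_eq_iff)

text \<open>Conjugation by some \<open>k\<close> fixing \<open>NP\<close> and sending
  \<open>q\<close> to \<open>SP\<close>. The similarity of the derivatives is stated as an
  intertwining relation, which avoids matrix inverses.\<close>

lemma conj_into_polar_stabilizer:
  assumes "g \<in> G" "g NP = NP" "g q = q" "q \<noteq> NP"
  obtains h k where "h \<in> G" "h NP = NP" "h SP = SP" "k \<in> G" "k NP = NP"
    "Dm h NP ** Dm k NP = Dm k NP ** Dm g NP"
proof -
  obtain k where k: "k \<in> G" "k NP = NP" "k q = SP"
    by (rule stabilizer_transitive[of NP q SP]) (use assms in auto)
  have kinv: "inv k NP = NP" "inv k SP = q" using k by (auto intro: inv_fixes)
  define h where "h = k \<circ> g \<circ> inv k"
  have h: "h \<in> G" "h NP = NP" "h SP = SP"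
    using k kinv assms by (auto simp: h_def)
  have "h \<circ> k = k \<circ> g" using k by (auto simp: h_def fun_eq_iff)
  then have "Dm h NP ** Dm k NP = Dm k NP ** Dm g NP"
    using Dm_comp_in[OF h(1) k(1), of NP] Dm_comp_in[OF k(1) assms(1), of NP] k assms by simp
  then show ?thesis using that h k by blast
qed

text \<open>Three stages: \<open>two\<close> treats maps with a second fixed point by similarity to
  a polar one, \<open>one\<close> writes any map fixing \<open>NP\<close> as a product of two such
  maps, and the general case rotates both \<open>p\<close> and \<open>g p\<close> to
  \<open>NP\<close>.\<close>

lemma det_Dm_eq_1:
  assumes polar: "\<And>h. h \<in> G \<Longrightarrow> h NP = NP \<Longrightarrow> h SP = SP \<Longrightarrow> det (Dm h NP) = 1"
    and g: "g \<in> G"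
  shows "det (Dm g p) = 1"
proof -
  have two: "det (Dm f NP) = 1" if f: "f \<in> G" "f NP = NP" "f q = q" "q \<noteq> NP" for f q
  proof -
    obtain h k where hk: "h \<in> G" "h NP = NP" "h SP = SP" "k \<in> G" "k NP = NP"
        "Dm h NP ** Dm k NP = Dm k NP ** Dm f NP"
      by (rule conj_into_polar_stabilizer[OF f])
    then have "det (Dm h NP) * det (Dm k NP) = det (Dm k NP) * det (Dm f NP)"
      using det_mul by metis
    moreover have "det (Dm k NP) > 0" using hk by (simp add: det_Dm_pos)
    ultimately show ?thesis using polar hk by simp
  qed
  have one: "det (Dm f NP) = 1" if f: "f \<in> G" "f NP = NP" for f
  proof (cases "f SP = SP")
    case False
    have w: "f SP \<noteq> NP" using f apply_eq_iff[of f SP NP] by simp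
    obtain q where q: "q \<notin> {NP, SP, f SP}" using S2_avoid_finite[of "{NP, SP, f SP}"] by blast
    \<comment> \<open>The extra fixed point \<open>q\<close> makes \<open>two\<close> applicable to
      \<open>k\<close>, while \<open>inv k \<circ> f\<close> fixes both poles.\<close>
    obtain k where k: "k \<in> G" "k NP = NP" "k q = q" "k SP = f SP"
      by (rule transitive_3[of NP q SP NP q "f SP"]) (use q w in auto)
    define l where "l = inv k \<circ> f"
    have l: "l \<in> G" "l NP = NP" "l SP = SP"
      using k f by (auto simp: l_def intro: inv_fixes)
    have "f = k \<circ> l" using k by (auto simp: l_def fun_eq_iff)
    then have "det (Dm f NP) = det (Dm k NP) * det (Dm l NP)"
      using Dm_comp_in[OF k(1) l(1), of NP] l by (simp add: det_mul)
    then show ?thesis using polar[OF l] two[OF k(1,2,3)] q by simp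
  qed (use polar f in simp)
  obtain P where P: "rotation_matrix P" "rot P NP = p" by (rule rot_exists)
  obtain Q where Q: "rotation_matrix Q" "rot Q (g p) = NP" by (rule rot_exists)
  have "det (Dm (rot Q \<circ> (g \<circ> rot P)) NP) = 1"
    using P Q g by (intro one) auto
  moreover have "Dm (rot Q \<circ> (g \<circ> rot P)) NP = Q ** (Dm g p ** P)"
    using P Q g by (simp add: Dm_comp_in Dm_rot)
  ultimately show ?thesis using P(1) Q(1) by (simp add: det_mul rotation_matrix_def)
qed

text \<open>Otherwise every radial extension preserves volume. But if \<open>h\<close> fixes the
  poles and lowers all other heights, the extension of its inverse maps the upper half ball into
  itself and misses a nonempty open part of it.\<close>

lemma exists_polar_det_neq_1:
  obtains h where "h \<in> G" "h NP = NP" "h SP = SP" "det (Dm h NP) \<noteq> 1"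
proof (rule ccontr)
  assume "\<not> thesis"
  then have "det (Dm h NP) = 1" if "h \<in> G" "h NP = NP" "h SP = SP" for h
    using \<open>\<And>h. \<lbrakk>h \<in> G; h NP = NP; h SP = SP; det (Dm h NP) \<noteq> 1\<rbrakk> \<Longrightarrow> thesis\<close> that by blast
  then have det1: "det (Dm g p) = 1" if "g \<in> G" for g p using det_Dm_eq_1 that by blast
  \<comment> \<open>A rational point below the equator; sending the equatorial point
    \<open>EP\<close> to it excludes the rotation and upward cases of the trichotomy.\<close>
  define q where "q = Abs_S2 (vector [3/5, 0, -4/5])"
  have q: "Rep_S2 q = vector [3/5, 0, -4/5]"
    unfolding q_def by (rule Rep_Abs_S2) (simp add: norm_eq_1_vec3 power_divide)
  then have htq: "ht q = -4/5" by simp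
  then have qp: "q \<noteq> NP" "q \<noteq> SP" by auto
  obtain h where h: "h \<in> G" "h NP = NP" "h SP = SP" "h EP = q"
    by (rule transitive_3[of NP SP EP NP SP q]) (use qp in auto)
  have down: "ht (h p) < ht p" if "p \<noteq> NP" "p \<noteq> SP" for p
    using h(1-3)
  proof (cases rule: height_trichotomy)
    case (rotation c s)
    then have "ht (h EP) = ht EP"
      by (simp add: Rep_rot rotation_rz mat3_vec_components)
    then show ?thesis using h htq by simp
  next
    case up
    from up[of EP] show ?thesis using h htq by simp
  qed (use that in blast)
  define F where "F = rad_ext (inv h)"
  define U where "U = {x :: real^3. norm x < 1 \<and> x$3 > 0}"
  \<comment> \<open>The part of the upper half ball that \<open>h\<close> pushes below the
    equatorial plane; it will be the set missed by \<open>F\<close>.\<close>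
  define W where "W = {y \<in> - {0}. rad_ext h y $ 3 < 0} \<inter> U"
  have U0: "0 \<notin> U" by (simp add: U_def)
  have dir: "rad_ext g x $ 3 = norm x * ht (g (Abs_S2 (x /\<^sub>R norm x)))"
    "x \<noteq> 0 \<Longrightarrow> x $ 3 = norm x * ht (Abs_S2 (x /\<^sub>R norm x))" for g x
    by (simp_all add: rad_ext_def Rep_Abs_S2)
  have oU: "open U"
    unfolding U_def by (intro open_Collect_conj open_Collect_less continuous_intros)
  have FU: "F ` U \<subseteq> U"
  proof
    fix y assume "y \<in> F ` U"
    then obtain x where x: "norm x < 1" "x$3 > 0" "y = F x" by (auto simp: U_def)
    then have x0: "x \<noteq> 0" by auto
    define p where "p = Abs_S2 (x /\<^sub>R norm x)"
    have p: "ht p > 0" using dir(2)[OF x0] x(2) x0 by (simp add: p_def zero_less_mult_iff)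
    have "ht (inv h p) > 0"
    proof (cases "p = NP")
      case True
      then have "inv h p = NP" using h by (auto intro: inv_fixes)
      then show ?thesis by simp
    next
      case False
      have "p \<noteq> SP" using p by auto
      then have "inv h p \<noteq> NP" "inv h p \<noteq> SP"
        using False h by (metis inv_apply(2))+
      then show ?thesis using down[of "inv h p"] h p by simp
    qed
    then show "y \<in> U" using x x0 dir(1)[of "inv h" x] by (simp add: U_def F_def p_def)
  qed
  have "open ((\<lambda>y. rad_ext h y $ 3) -` {..<0} \<inter> (- {0}))"
    by (rule continuous_on_open_vimage[THEN iffD1, rule_format])
       (use h in \<open>auto intro!: continuous_intros continuous_on_rad_ext\<close>)
  then have oV: "open {y \<in> - {0}. rad_ext h y $ 3 < 0}"
    by (simp add: vimage_def Int_def conj_commute)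
  then have oW: "open W" unfolding W_def using oU by blast
  have "W \<noteq> {}"
  proof -
    \<comment> \<open>The point \<open>e\<close> lies on the equatorial plane and its image strictly
      below. Moving \<open>e\<close> slightly upwards enters \<open>U\<close> while the image stays
      below by openness.\<close>
    define e where "e = (1/2) *\<^sub>R Rep_S2 EP"
    have "rad_ext h e = (1/2) *\<^sub>R Rep_S2 q"
      using h by (simp add: e_def rad_ext_scaleR)
    then have eV: "e \<in> {y \<in> - {0}. rad_ext h y $ 3 < 0} \<inter> ball 0 1"
      using htq by (simp add: e_def)
     have "open ({y \<in> - {0}. rad_ext h y $ 3 < 0} \<inter> ball 0 1)"
      using oV by (intro open_Int open_ball)
    from this eV obtain r where r: "r > 0" "ball e r \<subseteq> {y \<in> - {0}. rad_ext h y $ 3 < 0} \<inter> ball 0 1"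
      by (rule openE)
    define y where "y = e + (r/2) *\<^sub>R axis 3 1"
    have "y \<in> ball e r" using r(1) by (simp add: y_def dist_norm norm_axis_1)
    then have "y \<in> {y \<in> - {0}. rad_ext h y $ 3 < 0} \<inter> ball 0 1" using r(2) by blast
    moreover have "y $ 3 > 0" using r(1) by (simp add: y_def e_def)
    ultimately have "y \<in> W" by (simp add: W_def U_def)
    then show ?thesis by blast
  qed
  then have "\<not> negligible W" using oW open_not_negligible by blast
  have mU: "U \<in> lmeasurable"
    by (rule lmeasurable_open[OF _ oU]) (rule bounded_subset[of "ball 0 1"], auto simp: U_def)
  have mW: "W \<in> lmeasurable"
    by (rule lmeasurable_open[OF _ oW]) (rule bounded_subset[of "ball 0 1"], auto simp: W_def U_def)
  \<comment> \<open>Change of variables; by \<open>det1\<close> the integrand is the constant 1, so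
    \<open>F\<close> preserves the volume of \<open>U\<close>.\<close>
  have "F ` U \<in> lmeasurable \<and> measure lebesgue (F ` U) = measure lebesgue U
    \<longleftrightarrow> ((\<lambda>x. \<bar>det (matrix ((\<lambda>v. Dm (inv h) (Abs_S2 (x /\<^sub>R norm x)) *v v)))\<bar>) has_integral measure lebesgue U) U"
  proof (rule has_measure_differentiable_image)
    show "U \<in> sets lebesgue" using mU by blast
    show "inj_on F U" unfolding F_def using h rad_ext_inv(2)[of h] by (intro inj_on_inverseI)
    show "(F has_derivative (*v) (Dm (inv h) (Abs_S2 (x /\<^sub>R norm x)))) (at x within U)" if "x \<in> U" for x
      unfolding F_def using that h U0
      by (auto intro!: has_derivative_at_withinI[OF rad_ext_has_derivative_at])
  qed
  moreover have "((\<lambda>x::real^3. 1::real) has_integral measure lebesgue U) U"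
    unfolding lmeasure_integral[OF mU] using mU lmeasurable_iff_integrable_on
    by (intro integrable_integral) blast
  ultimately have F: "F ` U \<in> lmeasurable" "measure lebesgue (F ` U) = measure lebesgue U"
    using det1[of "inv h"] h by auto
  have "F ` U \<inter> W = {}"
  proof -
    have "rad_ext h y $ 3 > 0" if "y \<in> F ` U" for y
      using that h by (auto simp: F_def U_def rad_ext_inv)
    then show ?thesis by (force simp: W_def)
  qed
  then have "measure lebesgue (F ` U \<union> W) = measure lebesgue (F ` U) + measure lebesgue W"
    using F mW by (simp add: measure_Un3)
  moreover have "measure lebesgue (F ` U \<union> W) \<le> measure lebesgue U"
    using FU F(1) mU mW by (intro measure_mono_fmeasurable) (auto simp: W_def)
  ultimately have "measure lebesgue W \<le> 0" using F by simp
  then have "measure lebesgue W = 0" by (simp add: measure_le_0_iff)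
  then have "negligible W" using mW negligible_iff_measure by blast
  then show False using \<open>\<not> negligible W\<close> by blast
qed

text \<open>Start from a polar element with determinant different from 1, invert it if the
  determinant exceeds 1, and take a high power. The derivative is then a similarity by conformality,
  and a rotation removes its angular part.\<close>

lemma exists_polar_dilation:
  assumes "\<epsilon> > 0"
  obtains h l where "h \<in> G" "h NP = NP" "h SP = SP" "0 < l" "l < \<epsilon>"
    "Dm h NP $ 1 $ 1 = l" "Dm h NP $ 1 $ 2 = 0" "Dm h NP $ 2 $ 1 = 0" "Dm h NP $ 2 $ 2 = l"
proof -
  obtain h0 where h0: "h0 \<in> G" "h0 NP = NP" "h0 SP = SP" "det (Dm h0 NP) \<noteq> 1"
    by (rule exists_polar_det_neq_1)
  have "\<exists>h. h \<in> G \<and> h NP = NP \<and> h SP = SP \<and> det (Dm h NP) < 1"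
  proof (cases "det (Dm h0 NP) < 1")
    case False
    have "Dm (inv h0) NP ** Dm h0 NP = mat 1"
      using Dm_comp_in[of "inv h0" h0 NP] h0 by (simp add: inv_comp Dm_id)
    then have "det (Dm (inv h0) NP) * det (Dm h0 NP) = 1" by (metis det_I det_mul)
    moreover have "det (Dm h0 NP) > 1" using False h0 by simp
    ultimately have "det (Dm (inv h0) NP) < 1"
      using mult_right_mono[of 1 "det (Dm (inv h0) NP)" "det (Dm h0 NP)"] by linarith
    then show ?thesis
      using h0 by (intro exI[of _ "inv h0"]) (auto intro: inv_fixes)
  qed (use h0 in blast)
  then obtain h1 where h1: "h1 \<in> G" "h1 NP = NP" "h1 SP = SP" "det (Dm h1 NP) < 1" by blast
  define \<delta> where "\<delta> = det (Dm h1 NP)"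
  have \<delta>: "0 < \<delta>" "\<delta> < 1" using h1 by (simp_all add: \<delta>_def det_Dm_pos)
  have pow: "(h1 ^^ n) \<in> G \<and> (h1 ^^ n) NP = NP \<and> (h1 ^^ n) SP = SP \<and> det (Dm (h1 ^^ n) NP) = \<delta> ^ n" for n
  proof (induction n)
    case 0
    then show ?case using id_in Dm_id[of NP] by (simp add: id_def)
  next
    case (Suc n)
    have "det (Dm (h1 \<circ> h1 ^^ n) NP) = \<delta> ^ Suc n"
      using Suc h1 Dm_comp_in[of h1 "h1 ^^ n" NP] by (simp add: det_mul \<delta>_def)
    moreover have "h1 \<circ> h1 ^^ n \<in> G" using Suc h1 by blast
    moreover have "(h1 \<circ> h1 ^^ n) NP = NP" "(h1 \<circ> h1 ^^ n) SP = SP" using Suc h1 by simp_all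
    ultimately show ?case unfolding funpow.simps(2) by blast
  qed
  \<comment> \<open>The determinant of the block is the square of the dilation factor
    \<open>l\<close>, hence the bound by the square of \<open>\<epsilon>\<close>.\<close>
  obtain n where n: "\<delta> ^ n < \<epsilon>\<^sup>2"
    using real_arch_pow_inv[of "\<epsilon>\<^sup>2" \<delta>] assms \<delta> by auto
  define h2 where "h2 = h1 ^^ n"
  have h2: "h2 \<in> G" "h2 NP = NP" "h2 SP = SP" "det (Dm h2 NP) = \<delta> ^ n"
    using pow by (simp_all add: h2_def)
  define a b where "a = Dm h2 NP $ 1 $ 1" and "b = Dm h2 NP $ 2 $ 1"
  have M: "Dm h2 NP $ 1 $ 1 = a" "Dm h2 NP $ 2 $ 1 = b" "Dm h2 NP $ 1 $ 2 = - b" "Dm h2 NP $ 2 $ 2 = a"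
    using conformal_at_pole[OF h2(1-3)] by (simp_all add: a_def b_def)
  have d: "a\<^sup>2 + b\<^sup>2 = \<delta> ^ n"
    using h2(4) det_Dm_NP[OF in_Diff[OF h2(1)] h2(2)] M by (simp add: power2_eq_square)
  define l where "l = sqrt (a\<^sup>2 + b\<^sup>2)"
  have l2: "l\<^sup>2 = a\<^sup>2 + b\<^sup>2" by (simp add: l_def)
  have l: "l > 0" using d \<delta> by (simp add: l_def)
  have le: "l < \<epsilon>" using n assms unfolding l_def d by (intro real_less_lsqrt) auto
  have c1: "(a / l)\<^sup>2 + (- b / l)\<^sup>2 = 1"
    using l by (simp add: power_divide add_divide_distrib[symmetric] l2[symmetric])
  \<comment> \<open>The block of \<open>h2\<close> is multiplication by \<open>a + \<i> b\<close>;
    the rotation multiplies by its conjugate divided by \<open>l\<close>.\<close>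
  define h where "h = rot (rz (a / l) (- b / l)) \<circ> h2"
  have h: "h \<in> G" "h NP = NP" "h SP = SP"
    using h2 c1 rotation_rz[OF c1] rot_rz_poles[OF c1] by (auto simp: h_def)
  have Dh: "Dm h NP = rz (a / l) (- b / l) ** Dm h2 NP"
    unfolding h_def using Dm_comp_in[OF rot_in[OF rotation_rz[OF c1]] h2(1), of NP]
    unfolding Dm_rot[OF rotation_rz[OF c1]] .
  have ll: "(a * a + b * b) / l = l" using l l2 by (simp add: field_simps power2_eq_square)
  show ?thesis
  proof (rule that[OF h l le])
    show "Dm h NP $ 1 $ 1 = l" "Dm h NP $ 2 $ 2 = l"
      using ll by (simp_all add: Dh mat3_mult_components M add_divide_distrib Dm_NP_block[OF in_Diff[OF h2(1)] h2(2)])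
    show "Dm h NP $ 1 $ 2 = 0" "Dm h NP $ 2 $ 1 = 0"
      by (simp_all add: Dh mat3_mult_components M Dm_NP_block[OF in_Diff[OF h2(1)] h2(2)])
  qed
qed

section \<open>Conformality of all elements of the group\<close>

text \<open>Outside a small cap around the attracting fixed point, the inverse map preserves a closed disc,
  to which Brouwer's theorem applies.\<close>

lemma second_fixed_point:
  assumes g: "g \<in> G" "g NP = NP"
    and contr: "\<And>v. v$3 = 0 \<Longrightarrow> norm (Dm g NP *v v) \<le> norm v / 4"
  obtains q where "q \<noteq> NP" "g q = q"
proof -
  have "(rad_ext g has_derivative (\<lambda>v. Dm g NP *v v)) (at (Rep_S2 NP))"
    using g by (simp add: rad_ext_has_derivative)
  then obtain d0 where d0: "d0 > 0" "\<And>y. norm (y - Rep_S2 NP) < d0 \<Longrightarrow>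
      norm (rad_ext g y - Rep_S2 NP - Dm g NP *v (y - Rep_S2 NP)) \<le> 1/4 * norm (y - Rep_S2 NP)"
    unfolding has_derivative_at_alt using g by (elim conjE allE[of _ "1/4"]) auto
  define d where "d = min d0 1"
  have d: "0 < d" "d \<le> d0" "d \<le> 1" using d0 by (auto simp: d_def)
  \<comment> \<open>Moving closer to \<open>NP\<close> is the same as rising. The linear part
    contributes at most a quarter of \<open>norm w\<close> horizontally and
    \<open>\<bar>w$3\<bar>\<close>, which is quadratic in \<open>norm w\<close>, vertically; the
    remainder adds another quarter. Since \<open>norm w < 1\<close>, the sum stays below
    \<open>norm w\<close>.\<close>
  have up: "ht (g p) > ht p" if p: "p \<noteq> NP" "norm (Rep_S2 p - Rep_S2 NP) < d" for p
  proof -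
    define w where "w = Rep_S2 p - Rep_S2 NP"
    define u where "u = w - w$3 *\<^sub>R axis 3 1"
    have u3: "u$3 = 0" by (simp add: u_def)
    have w3: "w$3 = - (norm w)\<^sup>2 / 2" using norm_diff_NP[of p] by (simp add: w_def)
    have w0: "norm w > 0" using p by (simp add: w_def Rep_S2_eq_iff)
    have "(norm u)\<^sup>2 \<le> (norm w)\<^sup>2"
      by (simp add: power2_norm_eq_inner inner_vec_def sum_3 u_def axis_def)
    then have nu: "norm u \<le> norm w" by simp
    have wd: "w = u + w$3 *\<^sub>R Rep_S2 NP" by (simp add: u_def Rep_NP)
    have "Dm g NP *v w = Dm g NP *v u + w$3 *\<^sub>R Rep_S2 NP"
      by (subst wd, simp only: matrix_vector_right_distrib matrix_vector_mult_scaleR)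
         (use g Dm_radial[of g NP] in simp)
    then have "norm (Dm g NP *v w) \<le> norm u / 4 + \<bar>w$3\<bar>"
      using contr[OF u3] norm_triangle_ineq[of "Dm g NP *v u" "w$3 *\<^sub>R Rep_S2 NP"] by simp
    also have "\<dots> \<le> norm w / 4 + (norm w)\<^sup>2 / 2" using nu w3 by simp
    finally have 1: "norm (Dm g NP *v w) \<le> norm w / 4 + (norm w)\<^sup>2 / 2" .
    have 2: "norm (Rep_S2 (g p) - Rep_S2 NP - Dm g NP *v w) \<le> norm w / 4"
      using d0(2)[of "Rep_S2 p"] p d by (simp add: w_def)
    have "norm (Rep_S2 (g p) - Rep_S2 NP) \<le> norm w / 2 + (norm w)\<^sup>2 / 2"
      using 1 2 norm_triangle_ineq[of "Rep_S2 (g p) - Rep_S2 NP - Dm g NP *v w" "Dm g NP *v w"] by simp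
    moreover have "(norm w)\<^sup>2 < norm w"
      using w0 p d by (simp add: w_def power2_eq_square)
    ultimately have "norm (Rep_S2 (g p) - Rep_S2 NP) < norm w" by linarith
    then have "(norm (Rep_S2 (g p) - Rep_S2 NP))\<^sup>2 < (norm w)\<^sup>2"
      by (intro power_strict_mono) auto
    then show ?thesis by (simp add: w_def norm_diff_NP)
  qed
  \<comment> \<open>Height above \<open>a\<close> means squared chordal distance below a quarter of
    \<open>d\<^sup>2\<close>, inside the range of \<open>up\<close>; \<open>d \<le> 1\<close> keeps
    \<open>a\<close> positive.\<close>
  define a where "a = 1 - d\<^sup>2 / 8"
  have a1: "a < 1" using d by (simp add: a_def)
  have a0: "a > 0" using d power_le_one[of d 2] by (simp add: a_def)
  have up': "ht (g p) > ht p" if "p \<noteq> NP" "ht p > a" for p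
  proof (rule up)
    define e where "e = d\<^sup>2"
    have "e > 0" using d(1) by (simp add: e_def)
    then have "1 - ht p < e / 2"
      using that(2) unfolding a_def e_def[symmetric] by linarith
    then have "(norm (Rep_S2 p - Rep_S2 NP))\<^sup>2 < d\<^sup>2"
      unfolding norm_diff_NP e_def[symmetric] by simp
    then show "norm (Rep_S2 p - Rep_S2 NP) < d" using d(1) by (intro power2_less_imp_less[of _ d]) auto
  qed fact
  \<comment> \<open>If \<open>inv g p\<close> lay above height \<open>a\<close>, applying
    \<open>g\<close> would raise it further and \<open>p\<close> would lie above \<open>a\<close>
    too.\<close>
  have down: "ht (inv g p) \<le> a" if "ht p \<le> a" for p
  proof (rule ccontr)
    assume q: "\<not> ht (inv g p) \<le> a"
    have "inv g p \<noteq> NP"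
    proof
      assume "inv g p = NP"
      then have "p = NP" using g inv_apply(2)[OF g(1), of p] by simp
      then show False using that a1 by simp
    qed
    then show False using up'[of "inv g p"] q that g by simp
  qed
  \<comment> \<open>The radius at which \<open>1 - a = 2 / (R\<^sup>2 + 1)\<close>, so the disc
    corresponds to the heights at most \<open>a\<close>.\<close>
  define R where "R = sqrt (2 / (1 - a) - 1)"
  have R1: "2 / (1 - a) - 1 > 0" using a1 a0 by (simp add: field_simps)
  have B: "z \<in> cball 0 R \<longleftrightarrow> unchart z $ 3 \<le> a" for z
  proof -
    have pos: "(cmod z)\<^sup>2 + 1 > 0" using zero_le_power2[of "cmod z"] by linarith
    have "z \<in> cball 0 R \<longleftrightarrow> sqrt ((cmod z)\<^sup>2) \<le> sqrt (2 / (1 - a) - 1)"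
      by (simp add: R_def)
    also have "\<dots> \<longleftrightarrow> (cmod z)\<^sup>2 \<le> 2 / (1 - a) - 1"
      by (rule real_sqrt_le_iff)
    also have "\<dots> \<longleftrightarrow> 1 - a \<le> 2 / ((cmod z)\<^sup>2 + 1)"
      using pos a1 by (simp add: field_simps)
    also have "\<dots> \<longleftrightarrow> unchart z $ 3 \<le> a"
      using one_minus_unchart_3[of z] by (simp add: cmod_power2) linarith
    finally show ?thesis .
  qed
  define P where "P z = Abs_S2 (unchart z)" for z
  have P: "Rep_S2 (P z) = unchart z" for z by (simp add: P_def Rep_Abs_S2)
  define \<phi> where "\<phi> z = chart (rad_ext (inv g) (unchart z))" for z
  have im: "Rep_S2 (inv g (P z)) = rad_ext (inv g) (unchart z)" for z
    using rad_ext_Rep[of "inv g" "P z"] P by simp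
  have cap: "ht (inv g (P z)) \<le> a" if "z \<in> cball 0 R" for z
    using down[of "P z"] that B P by simp
  \<comment> \<open>Brouwer is applied to \<open>inv g\<close> in the chart; the fixed point differs
    from \<open>NP\<close>, which is the point outside the chart.\<close>
  obtain z where z: "z \<in> cball 0 R" "\<phi> z = z"
  proof (rule brouwer[of "cball 0 R" \<phi>])
    show "cball (0::complex) R \<noteq> {}" using R1 by (simp add: R_def)
    show "continuous_on (cball 0 R) \<phi>"
      unfolding \<phi>_def
    proof (rule continuous_on_compose2[OF continuous_on_chart])
      show "continuous_on (cball 0 R) (\<lambda>z. rad_ext (inv g) (unchart z))"
        by (rule continuous_on_compose2[OF continuous_on_rad_ext continuous_on_unchart])
           (use g in auto)
      show "(\<lambda>z. rad_ext (inv g) (unchart z)) ` cball 0 R \<subseteq> {x. x $ 3 \<noteq> 1}"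
        using cap a1 im[symmetric] by fastforce
    qed
    show "\<phi> \<in> cball 0 R \<rightarrow> cball 0 R"
    proof
      fix z assume z: "z \<in> cball (0::complex) R"
      have "unchart (\<phi> z) = rad_ext (inv g) (unchart z)"
        unfolding \<phi>_def using cap[OF z] a1 im[of z] by (intro unchart_chart) auto
      then show "\<phi> z \<in> cball 0 R" using cap[OF z] im[of z] B by simp
    qed
  qed auto
  have "unchart (\<phi> z) = rad_ext (inv g) (unchart z)"
    unfolding \<phi>_def using cap[OF z(1)] a1 im[of z] by (intro unchart_chart) auto
  then have "Rep_S2 (inv g (P z)) = Rep_S2 (P z)" using z im[of z] P[of z] by simp
  then have "inv g (P z) = P z" by (simp add: Rep_S2_eq_iff)
  then have "g (P z) = P z" using inv_apply(2)[OF g(1), of "P z"] by simp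
  moreover have "P z \<noteq> NP" using P[of z] unchart_3_neq_1[of z] Rep_poles(3) by metis
  ultimately show ?thesis using that by blast
qed

text \<open>The discriminant of the characteristic polynomial separates conformal from non-conformal
  derivatives: after a suitable rotation it is positive for a non-conformal derivative, whereas a
  map with two fixed points has non-positive discriminant.  Composing with a strong dilation
  forces a second fixed point without changing the sign of the discriminant.\<close>

lemma conformal_at_NP:
  assumes g: "g \<in> G" "g NP = NP"
  shows "Dm g NP $ 1 $ 1 = Dm g NP $ 2 $ 2 \<and> Dm g NP $ 1 $ 2 = - Dm g NP $ 2 $ 1"
proof (rule ccontr)
  define a b c d where "a = Dm g NP $ 1 $ 1" and "b = Dm g NP $ 1 $ 2"
    and "c = Dm g NP $ 2 $ 1" and "d = Dm g NP $ 2 $ 2"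
  assume "\<not> ?thesis"
  then have "a - d \<noteq> 0 \<or> b + c \<noteq> 0" by (auto simp: a_def b_def c_def d_def)
  then have nc: "(a - d)\<^sup>2 + (b + c)\<^sup>2 > 0" by (simp only: sum_power2_gt_zero_iff)
  have det: "a * d - b * c > 0"
    using det_Dm_pos[of g NP] det_Dm_NP[of g] g by (simp add: a_def b_def c_def d_def)
  \<comment> \<open>Write the block as \<open>z \<mapsto> p z + q cnj z\<close>. The two sums of
    squares are four times the squared moduli of \<open>p\<close> and \<open>q\<close>, and the
    determinant is the difference of those squared moduli.\<close>
  have disc: "(a + d)\<^sup>2 + (b - c)\<^sup>2 = (a - d)\<^sup>2 + (b + c)\<^sup>2 + 4 * (a * d - b * c)"
    by (simp add: power2_eq_square algebra_simps)
  define L where "L = sqrt ((a + d)\<^sup>2 + (b - c)\<^sup>2)"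
  have L2: "L\<^sup>2 = (a + d)\<^sup>2 + (b - c)\<^sup>2" by (simp add: L_def)
  have L: "L > 0" unfolding L_def using nc det disc by simp
  \<comment> \<open>The unit number \<open>x + \<i> y\<close> is the direction of the conjugate of
    \<open>p\<close>. Composing with this rotation makes the complex-linear coefficient positive, so
    the trace becomes \<open>L\<close> and the discriminant becomes
    \<open>(a - d)\<^sup>2 + (b + c)\<^sup>2\<close>.\<close>
  define x y where "x = (a + d) / L" and "y = (b - c) / L"
  have xy: "x\<^sup>2 + y\<^sup>2 = 1"
    unfolding x_def y_def power_divide add_divide_distrib[symmetric] L2[symmetric] using L by simp
  have tr: "(a * x + b * y) + (d * x - c * y) = L"
  proof -
    have "(a * x + b * y) + (d * x - c * y) = ((a + d)\<^sup>2 + (b - c)\<^sup>2) / L"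
      by (simp add: x_def y_def power2_eq_square add_divide_distrib diff_divide_distrib algebra_simps)
    then show ?thesis using L unfolding L2[symmetric] by (simp add: power2_eq_square)
  qed
  define g1 where "g1 = g \<circ> rot (rz x y)"
  have rxy: "rotation_matrix (rz x y)" by (rule rotation_rz[OF xy])
  have g1: "g1 \<in> G" "g1 NP = NP" using g rxy xy by (auto simp: g1_def)
  have M1: "Dm g1 NP = Dm g NP ** rz x y"
    unfolding g1_def using Dm_comp_in[OF g(1) rot_in[OF rxy], of NP] xy by (simp add: Dm_rot[OF rxy])
  have M1c: "Dm g1 NP $ 1 $ 1 = a * x + b * y" "Dm g1 NP $ 2 $ 2 = d * x - c * y"
    by (simp_all add: M1 mat3_mult_components a_def b_def c_def d_def)
  have det1: "det (Dm g1 NP) = a * d - b * c"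
    using rxy det_Dm_NP[OF in_Diff[OF g(1)] g(2)]
    by (simp add: M1 det_mul rotation_matrix_def a_def b_def c_def d_def)
  obtain K where K: "K > 0" "\<And>v. norm (Dm g1 NP *v v) \<le> norm v * K"
    using bounded_linear.pos_bounded[OF matrix_vector_mul_bounded_linear[of "Dm g1 NP"]] by blast
  \<comment> \<open>With operator bound \<open>K\<close> for \<open>g1\<close>, this
    \<open>l\<close> makes \<open>g1 \<circ> h\<close> contract horizontal vectors by at least a
    factor of 4, as \<open>second_fixed_point\<close> requires.\<close>
  obtain h l where h: "h \<in> G" "h NP = NP" "h SP = SP" and l: "0 < l" "l < 1 / (4 * K)"
    and Dh: "Dm h NP $ 1 $ 1 = l" "Dm h NP $ 1 $ 2 = 0" "Dm h NP $ 2 $ 1 = 0" "Dm h NP $ 2 $ 2 = l"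
    by (rule exists_polar_dilation[of "1 / (4 * K)"]) (use K in auto)
  define g2 where "g2 = g1 \<circ> h"
  have g2: "g2 \<in> G" "g2 NP = NP" using g1 h by (auto simp: g2_def)
  have M2: "Dm g2 NP = Dm g1 NP ** Dm h NP"
    unfolding g2_def using Dm_comp_in[OF g1(1) h(1), of NP] h by simp
  have contr: "norm (Dm g2 NP *v v) \<le> norm v / 4" if v: "v $ 3 = 0" for v
  proof -
    have "Dm h NP *v v = l *\<^sub>R v"
      using v by (simp add: vec3_eq_iff mat3_vec_components Dh Dm_NP_block[OF in_Diff[OF h(1)] h(2)])
    then have "Dm g2 NP *v v = l *\<^sub>R (Dm g1 NP *v v)"
      by (simp add: M2 matrix_vector_mul_assoc[symmetric] matrix_vector_mult_scaleR)
    then have "norm (Dm g2 NP *v v) \<le> l * (norm v * K)"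
      using K(2)[of v] l(1) by (simp add: mult_left_mono)
    also have "\<dots> = (l * K) * norm v" by simp
    also have "\<dots> \<le> (1 / 4) * norm v"
      using l(2) K(1) by (intro mult_right_mono) (simp_all add: field_simps)
    finally show ?thesis by simp
  qed
  obtain q where q: "q \<noteq> NP" "g2 q = q"
    by (rule second_fixed_point[OF g2 contr])
  obtain f k where f: "f \<in> G" "f NP = NP" "f SP = SP" and k: "k \<in> G" "k NP = NP"
    and fk: "Dm f NP ** Dm k NP = Dm k NP ** Dm g2 NP"
    by (rule conj_into_polar_stabilizer[OF g2 q(2,1)])
  have kd: "det (Dm k NP) > 0" using k by (simp add: det_Dm_pos)
  have dets: "det (Dm f NP) = det (Dm g2 NP)"
    using arg_cong[OF fk, of det] kd by (simp add: det_mul)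
  obtain K' where K': "Dm k NP ** K' = mat 1" "K' ** Dm k NP = mat 1"
    using kd invertible_det_nz[of "Dm k NP"] unfolding invertible_def by auto
  have "Dm f NP = (Dm k NP ** Dm g2 NP) ** K'"
    using arg_cong[OF fk, of "\<lambda>A. A ** K'"] K' by (simp add: matrix_mul_assoc[symmetric])
  then have "trace (Dm f NP) = trace (K' ** (Dm k NP ** Dm g2 NP))"
    by (simp only: trace_mul_sym[of "Dm k NP ** Dm g2 NP" K'])
  also have "\<dots> = trace (Dm g2 NP)" by (simp add: matrix_mul_assoc K')
  finally have traces: "trace (Dm f NP) = trace (Dm g2 NP)" .
  \<comment> \<open>Subtracting 1 removes the vertical eigenvalue and leaves the trace of the
    horizontal block.\<close>
  have tf: "trace (Dm f NP) - 1 = 2 * Dm f NP $ 1 $ 1"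
    using conformal_at_pole[OF f] by (simp add: trace_def sum_3 Dm_NP_block[OF in_Diff[OF f(1)] f(2)])
  have df: "det (Dm f NP) = (Dm f NP $ 1 $ 1)\<^sup>2 + (Dm f NP $ 2 $ 1)\<^sup>2"
    using conformal_at_pole[OF f] det_Dm_NP[OF in_Diff[OF f(1)] f(2)] by (simp add: power2_eq_square)
  \<comment> \<open>The block of \<open>f\<close> is multiplication by a complex number, so its
    discriminant is minus a square. For \<open>g2\<close>, whose trace and determinant agree with
    those of \<open>f\<close>, it is \<open>l\<^sup>2\<close> times a positive number.\<close>
  have "(trace (Dm f NP) - 1)\<^sup>2 - 4 * det (Dm f NP) \<le> 0"
    unfolding tf df by simp
  moreover have "trace (Dm g2 NP) - 1 = l * L"
    unfolding tr[symmetric]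
    by (simp add: M2 trace_def sum_3 mat3_mult_components Dh M1c algebra_simps
        Dm_NP_block[OF in_Diff[OF h(1)] h(2)] Dm_NP_block[OF in_Diff[OF g1(1)] g1(2)])
  moreover have "det (Dm g2 NP) = l\<^sup>2 * (a * d - b * c)"
    using det_Dm_NP[OF in_Diff[OF h(1)] h(2)] by (simp add: M2 det_mul det1 Dh power2_eq_square)
  ultimately have "l\<^sup>2 * L\<^sup>2 - 4 * (l\<^sup>2 * (a * d - b * c)) \<le> 0"
    by (simp add: traces dets power_mult_distrib)
  then have "l\<^sup>2 * ((a - d)\<^sup>2 + (b + c)\<^sup>2) \<le> 0"
    unfolding L2 disc by (simp add: algebra_simps)
  then show False using nc l(1) by (simp add: mult_le_0_iff)
qed

text \<open>The cross product with the normal is the quarter turn of the tangent plane. Rotating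
  source and target to \<open>NP\<close> reduces the claim to \<open>conformal_at_NP\<close>,
  because rotations commute with the cross product.\<close>

lemma conformal:
  assumes g: "g \<in> G"
  shows "Dm g p *v (Rep_S2 p \<times> v) = Rep_S2 (g p) \<times> (Dm g p *v v)"
proof -
  obtain P where P: "rotation_matrix P" "rot P NP = p" by (rule rot_exists)
  obtain Q where Q: "rotation_matrix Q" "rot Q (g p) = NP" by (rule rot_exists)
  define f where "f = rot Q \<circ> (g \<circ> rot P)"
  have f: "f \<in> G" "f NP = NP" using P Q g by (auto simp: f_def)
  have Df: "Dm f NP = Q ** (Dm g p ** P)"
    unfolding f_def using P Q g by (simp add: Dm_comp_in Dm_rot)
  have eq: "Dm f NP *v (Rep_S2 NP \<times> w) = Rep_S2 NP \<times> (Dm f NP *v w)" for w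
    using conformal_at_NP[OF f] Dm_NP_block[OF in_Diff[OF f(1)] f(2)]
    by (simp add: vec3_eq_iff mat3_vec_components cross_components)
  have inv: "transpose A *v (A *v u) = u" "A *v (transpose A *v u) = u"
    if "rotation_matrix A" for A :: "real^3^3" and u
    using that by (auto simp only: matrix_vector_mul_assoc rotation_matrix_def orthogonal_matrix_def
        matrix_vector_mul_lid)
  define w where "w = transpose P *v v"
  have v: "v = P *v w" by (simp only: w_def inv(2)[OF P(1)])
  have p: "Rep_S2 p = P *v Rep_S2 NP" using P Rep_rot by metis
  have q: "Rep_S2 NP = Q *v Rep_S2 (g p)" using Q Rep_rot by metis
  have "Q *v (Dm g p *v (Rep_S2 p \<times> v)) = Dm f NP *v (Rep_S2 NP \<times> w)"
    unfolding v p cross_rotation_matrix[OF P(1)] Df by (simp add: matrix_vector_mul_assoc)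
  also have "\<dots> = (Q *v Rep_S2 (g p)) \<times> (Q *v (Dm g p *v v))"
    unfolding eq v by (simp add: q[symmetric] Df matrix_vector_mul_assoc)
  also have "\<dots> = Q *v (Rep_S2 (g p) \<times> (Dm g p *v v))"
    by (rule cross_rotation_matrix[OF Q(1)])
  finally show ?thesis using inv(1)[OF Q(1)] by metis
qed

end

section \<open>Moebius maps\<close>

lemma moeb_simps:
  "moeb a b c d None = (if c = 0 then None else Some (a / c))"
  "moeb a b c d (Some z) = (if c * z + d = 0 then None else Some ((a * z + b) / (c * z + d)))"
  by (simp_all add: moeb_def)

lemma moeb_scale:
  assumes "s \<noteq> 0" shows "moeb (a / s) (b / s) (c / s) (d / s) = moeb a b c d"
proof
  fix w
  have "c / s * z + d / s = (c * z + d) / s" "a / s * z + b / s = (a * z + b) / s" for z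
    by (simp_all add: add_divide_distrib)
  then show "moeb (a / s) (b / s) (c / s) (d / s) w = moeb a b c d w"
    using assms by (cases w) (simp_all add: moeb_simps)
qed

lemma moeb_inverse:
  assumes det: "a * d - b * c = 1" shows "moeb d (- b) (- c) a (moeb a b c d w) = w"
proof (cases w)
  case None
  then show ?thesis by (simp add: moeb_simps)
next
  case (Some z)
  show ?thesis
  proof (cases "c * z + d = 0")
    case True
    then have "c \<noteq> 0" using det by auto
    moreover have "d = - c * z" using True by (simp add: eq_neg_iff_add_eq_0 add.commute)
    ultimately show ?thesis using Some by (simp add: moeb_simps)
  next
    case False
    have 1: "- c * ((a * z + b) / (c * z + d)) + a = 1 / (c * z + d)"
    proof -
      have "- c * (a * z + b) + a * (c * z + d) = 1" using det by algebra
      then show ?thesis using False by (simp add: field_simps)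
    qed
    have 2: "d * ((a * z + b) / (c * z + d)) + - b = z / (c * z + d)"
    proof -
      have "d * (a * z + b) - b * (c * z + d) = z" using det by algebra
      then show ?thesis using False by (simp add: field_simps)
    qed
    have "moeb d (- b) (- c) a (Some ((a * z + b) / (c * z + d))) = Some z"
      unfolding moeb_simps(2) 1 2 using False by simp
    then show ?thesis using Some False by (simp add: moeb_simps(2))
  qed
qed

text \<open>After clearing denominators, equality of the two maps is an identity between polynomials
  of degree at most two. Agreement at infinity, 0 and 1 gives the leading coefficient, the constant
  term and one further value.\<close>

lemma moeb_eq_if_agree:
  assumes det: "a * d - b * c = 1" "a' * d' - b' * c' = 1"
    and agree: "moeb a b c d None = moeb a' b' c' d' None"
      "moeb a b c d (Some 0) = moeb a' b' c' d' (Some 0)"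
      "moeb a b c d (Some 1) = moeb a' b' c' d' (Some 1)"
  shows "moeb a b c d = moeb a' b' c' d'"
proof
  fix w
  have e1: "a * c' = a' * c"
    using agree(1) by (simp add: moeb_simps field_simps split: if_splits)
  have e2: "b * d' = b' * d"
    using agree(2) by (simp add: moeb_simps field_simps split: if_splits)
  have e3: "(a + b) * (c' + d') = (a' + b') * (c + d)"
    using agree(3) by (simp add: moeb_simps frac_eq_eq split: if_splits)
  have cross: "(a * z + b) * (c' * z + d') = (a' * z + b') * (c * z + d)" for z
    using e1 e2 e3 by algebra
  show "moeb a b c d w = moeb a' b' c' d' w"
  proof (cases w)
    case None
    then show ?thesis using agree(1) by simp
  next
    case (Some z)
    \<comment> \<open>Numerator and denominator never vanish together, so the cross-multiplied
      identity also decides when both values are infinite.\<close>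
    have "a * z + b \<noteq> 0" if "c * z + d = 0"
    proof
      assume "a * z + b = 0"
      then have "a * d - b * c = 0" using that by algebra
      then show False using det by simp
    qed
    moreover have "a' * z + b' \<noteq> 0" if "c' * z + d' = 0"
    proof
      assume "a' * z + b' = 0"
      then have "a' * d' - b' * c' = 0" using that by algebra
      then show False using det by simp
    qed
    ultimately show ?thesis
      using cross[of z] Some by (auto simp: moeb_simps frac_eq_eq)
  qed
qed

lemma stereo_stereo_inv: "stereo (stereo_inv w) = w"
proof (cases w)
  case None
  then show ?thesis by (simp add: stereo_def stereo_inv_def)
next
  case (Some z)
  then show ?thesis unfolding Some unchart_def[symmetric] stereo_eq by simp
qed

lemma norm_stereo_inv: "norm (stereo_inv w) = 1"
proof (cases w)
  case None
  then show ?thesis by (simp add: stereo_inv_def norm_eq_1_vec3)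
next
  case (Some z)
  then show ?thesis unfolding Some unchart_def[symmetric] by simp
qed

lemma stereo_inv_stereo: "stereo_inv (stereo (Rep_S2 p)) = Rep_S2 p"
proof (cases "p = NP")
  case True
  then show ?thesis by (simp add: stereo_def stereo_inv_def vec3_eq_iff)
next
  case False
  then show ?thesis by (simp add: stereo_eq ht_eq_1_iff unchart_def[symmetric] unchart_chart)
qed

lemma stereo_poles: "stereo (Rep_S2 NP) = None" "stereo (Rep_S2 SP) = Some 0" "stereo (Rep_S2 EP) = Some 1"
  by (simp_all add: stereo_def complex_eq_iff)

lemma Moeb_iff:
  "g \<in> Moeb \<longleftrightarrow> (\<exists>a b c d. a * d - b * c = 1 \<and> (\<forall>p. stereo (Rep_S2 (g p)) = moeb a b c d (stereo (Rep_S2 p))))"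
proof -
  have "g = (\<lambda>p. Abs_S2 (stereo_inv (moeb a b c d (stereo (Rep_S2 p))))) \<longleftrightarrow>
    (\<forall>p. stereo (Rep_S2 (g p)) = moeb a b c d (stereo (Rep_S2 p)))" (is "?L \<longleftrightarrow> ?R") for a b c d
  proof
    assume ?L
    then show ?R by (simp add: Rep_Abs_S2 norm_stereo_inv stereo_stereo_inv)
  next
    assume R: ?R
    have "g p = Abs_S2 (stereo_inv (stereo (Rep_S2 (g p))))" for p
      by (simp only: stereo_inv_stereo Rep_S2_inverse)
    then show ?L using R by (simp add: fun_eq_iff)
  qed
  then show ?thesis unfolding Moeb_def by blast
qed

text \<open>Dividing all coefficients by a square root of the determinant normalizes it without
  changing the map.\<close>

lemma MoebI:
  assumes "a * d - b * c \<noteq> 0" "\<And>p. stereo (Rep_S2 (g p)) = moeb a b c d (stereo (Rep_S2 p))"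
  shows "g \<in> Moeb"
proof -
  define s where "s = csqrt (a * d - b * c)"
  have s: "s\<^sup>2 = a * d - b * c" "s \<noteq> 0" using assms(1) by (auto simp: s_def)
  have "a / s * (d / s) - b / s * (c / s) = (a * d - b * c) / s\<^sup>2"
    by (simp add: diff_divide_distrib power2_eq_square)
  then have "a / s * (d / s) - b / s * (c / s) = 1"
    unfolding s(1)[symmetric] using s(2) by simp
  moreover have "\<forall>p. stereo (Rep_S2 (g p)) = moeb (a / s) (b / s) (c / s) (d / s) (stereo (Rep_S2 p))"
    using assms(2) moeb_scale[OF s(2)] by simp
  ultimately show ?thesis unfolding Moeb_iff by blast
qed

section \<open>Conformality in the chart\<close>

definition dchart :: "real^3 \<Rightarrow> real^3 \<Rightarrow> complex" where
  "dchart x v = Complex (v$1 / (1 - x$3) + x$1 * v$3 / (1 - x$3)\<^sup>2) (v$2 / (1 - x$3) + x$2 * v$3 / (1 - x$3)\<^sup>2)"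

lemma has_derivative_vec_nth: "((\<lambda>x. x $ i) has_derivative (\<lambda>v. v $ i)) F" for i :: 3
  by (rule bounded_linear_imp_has_derivative) (rule bounded_linear_vec_nth)

lemma chart_has_derivative:
  assumes "x$3 \<noteq> 1" shows "(chart has_derivative dchart x) (at x)"
proof -
  have q: "((\<lambda>y. y$i / (1 - y$3)) has_derivative (\<lambda>v. v$i / (1 - x$3) + x$i * v$3 / (1 - x$3)\<^sup>2)) (at x)" for i
  proof -
    have "((\<lambda>y. y$i / (1 - y$3)) has_derivative
        (\<lambda>v. (v$i * (1 - x$3) - x$i * (0 - v$3)) / ((1 - x$3) * (1 - x$3)))) (at x)"
      by (intro has_derivative_divide' has_derivative_diff has_derivative_const has_derivative_vec_nth)
         (use assms in auto)
    then show ?thesis using assms by (simp add: add_divide_distrib power2_eq_square)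
  qed
  have "((\<lambda>y. complex_of_real (y$1 / (1 - y$3)) + \<i> * complex_of_real (y$2 / (1 - y$3))) has_derivative
     (\<lambda>v. complex_of_real (v$1 / (1 - x$3) + x$1 * v$3 / (1 - x$3)\<^sup>2)
        + \<i> * complex_of_real (v$2 / (1 - x$3) + x$2 * v$3 / (1 - x$3)\<^sup>2))) (at x)"
    by (intro has_derivative_add has_derivative_mult_right has_derivative_of_real q)
  then show ?thesis
    unfolding chart_def[abs_def] dchart_def[abs_def] Complex_eq .
qed

text \<open>The sign is negative because projection from the north pole reverses the orientation
  given by the outward normal. The same sign occurs in \<open>dunchart_i\<close>, and the two cancel
  in the coordinate expression of a map.\<close>

lemma dchart_cross:
  assumes "norm x = 1" "x$3 \<noteq> 1" "v \<bullet> x = 0"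
  shows "dchart x (x \<times> v) = - \<i> * dchart x v"
proof -
  define u where "u = 1 / (1 - x$3)"
  have u: "u * (1 - x$3) = 1" using assms(2) by (simp add: u_def)
  have n: "(x$1)\<^sup>2 + (x$2)\<^sup>2 + (x$3)\<^sup>2 = 1" using assms(1) norm_eq_1_vec3 by blast
  have o: "v$1 * x$1 + v$2 * x$2 + v$3 * x$3 = 0" using assms(3) by (simp add: inner_vec_def sum_3)
  have d: "dchart x v = Complex (v$1 * u + x$1 * v$3 * u\<^sup>2) (v$2 * u + x$2 * v$3 * u\<^sup>2)" for v
    by (simp add: dchart_def u_def power_divide)
  have 1: "(x$2 * v$3 - v$2 * x$3) * u + x$1 * (x$1 * v$2 - v$1 * x$2) * u\<^sup>2 = v$2 * u + x$2 * v$3 * u\<^sup>2"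
    using u n o by algebra
  have 2: "(x$3 * v$1 - v$3 * x$1) * u + x$2 * (x$1 * v$2 - v$1 * x$2) * u\<^sup>2 = - (v$1 * u + x$1 * v$3 * u\<^sup>2)"
    using u n o by algebra
  show ?thesis
    unfolding d cross_components using 1 2 by (auto simp add: complex_eq_iff)
qed

text \<open>The product rule applied to the form of \<open>unchart\<close> in
  \<open>unchart_eq\<close>; the second summand comes from differentiating the scalar
  factor.\<close>

definition dunchart :: "complex \<Rightarrow> complex \<Rightarrow> real^3" where
  "dunchart z w = (2 / ((Re z)\<^sup>2 + (Im z)\<^sup>2 + 1)) *\<^sub>R (Re w *\<^sub>R axis 1 1 + Im w *\<^sub>R axis 2 1) -
     (4 * (Re z * Re w + Im z * Im w) / ((Re z)\<^sup>2 + (Im z)\<^sup>2 + 1)\<^sup>2) *\<^sub>R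
       (Re z *\<^sub>R axis 1 1 + Im z *\<^sub>R axis 2 1 - axis 3 1)"

lemma unchart_eq: "unchart z =
  (2 / ((Re z)\<^sup>2 + (Im z)\<^sup>2 + 1)) *\<^sub>R (Re z *\<^sub>R axis 1 1 + Im z *\<^sub>R axis 2 1 - axis 3 1) + axis 3 1"
  using one_minus_unchart_3[of z]
  by (simp add: vec3_eq_iff unchart_components(1,2) axis_def)

lemma unchart_has_derivative: "(unchart has_derivative dunchart z) (at z)"
proof -
  let ?n = "\<lambda>z. (Re z)\<^sup>2 + (Im z)\<^sup>2 + 1"
  let ?L = "\<lambda>z. Re z *\<^sub>R axis 1 1 + Im z *\<^sub>R axis 2 1 - axis 3 1 :: real^3"
  have c: "((\<lambda>z. 2 / ?n z) has_derivative (\<lambda>w. - (4 * (Re z * Re w + Im z * Im w) / (?n z)\<^sup>2))) (at z)"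
  proof -
    have "(?n has_derivative (\<lambda>w. 2 * (Re z * Re w + Im z * Im w))) (at z)"
      by (auto intro!: derivative_eq_intros simp: algebra_simps)
    then have "((\<lambda>z. 2 / ?n z) has_derivative
        (\<lambda>w. (0 * ?n z - 2 * (2 * (Re z * Re w + Im z * Im w))) / (?n z * ?n z))) (at z)"
      by (intro has_derivative_divide' has_derivative_const) (assumption, rule sum_squares_plus_1_neq_0)
    moreover have "(\<lambda>w. (0 * ?n z - 2 * (2 * (Re z * Re w + Im z * Im w))) / (?n z * ?n z)) =
        (\<lambda>w. - (4 * (Re z * Re w + Im z * Im w) / (?n z)\<^sup>2))"
      unfolding minus_divide_left power2_eq_square by (simp add: algebra_simps)
    ultimately show ?thesis by simp
  qed
  have L: "(?L has_derivative (\<lambda>w. Re w *\<^sub>R axis 1 1 + Im w *\<^sub>R axis 2 1)) (at z)"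
    by (auto intro!: derivative_eq_intros)
  have "((\<lambda>z. (2 / ?n z) *\<^sub>R ?L z + axis 3 1) has_derivative
    (\<lambda>w. ((2 / ?n z) *\<^sub>R (Re w *\<^sub>R axis 1 1 + Im w *\<^sub>R axis 2 1) +
       (- (4 * (Re z * Re w + Im z * Im w) / (?n z)\<^sup>2)) *\<^sub>R ?L z) + 0)) (at z)"
    by (intro has_derivative_add has_derivative_scaleR c L has_derivative_const)
  then show ?thesis
    unfolding unchart_eq[abs_def] dunchart_def[abs_def] by simp
qed

lemma dunchart_components:
  fixes z w defines "c \<equiv> 2 / ((Re z)\<^sup>2 + (Im z)\<^sup>2 + 1)"
    and "s \<equiv> Re z * Re w + Im z * Im w"
  shows "dunchart z w $ 1 = c * Re w - c\<^sup>2 * s * Re z" "dunchart z w $ 2 = c * Im w - c\<^sup>2 * s * Im z"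
    "dunchart z w $ 3 = c\<^sup>2 * s"
  by (simp_all add: dunchart_def axis_def c_def s_def power_divide)

lemma unchart_components':
  fixes z defines "c \<equiv> 2 / ((Re z)\<^sup>2 + (Im z)\<^sup>2 + 1)"
  shows "unchart z $ 1 = c * Re z" "unchart z $ 2 = c * Im z" "unchart z $ 3 = 1 - c"
  by (simp_all add: unchart_eq axis_def c_def)

lemma dunchart_tangential: "dunchart z w \<bullet> unchart z = 0"
  and dunchart_i: "dunchart z (\<i> * w) = - (unchart z \<times> dunchart z w)"
proof -
  define c where "c = 2 / ((Re z)\<^sup>2 + (Im z)\<^sup>2 + 1)"
  have c: "c * ((Re z)\<^sup>2 + (Im z)\<^sup>2 + 1) = 2"
    by (rule nonzero_eq_divide_eq[THEN iffD1, OF sum_squares_plus_1_neq_0 c_def])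
  note comps = dunchart_components[of z, folded c_def] unchart_components'[of z, folded c_def]
  define x y a b where "x = Re z" and "y = Im z" and "a = Re w" and "b = Im w"
  have n: "2 - c * (x\<^sup>2 + y\<^sup>2 + 1) = 0" using c by (simp add: x_def y_def)
  show "dunchart z w \<bullet> unchart z = 0"
  proof -
    have "dunchart z w \<bullet> unchart z = c\<^sup>2 * (x * a + y * b) * (2 - c * (x\<^sup>2 + y\<^sup>2 + 1))"
      unfolding inner_vec_def sum_3 comps inner_real_def x_def y_def a_def b_def
      by (simp add: power2_eq_square algebra_simps)
    then show ?thesis unfolding n by simp
  qed
  have "dunchart z (\<i> * w) $ 1 + (unchart z \<times> dunchart z w) $ 1 = - b * c * (2 - c * (x\<^sup>2 + y\<^sup>2 + 1))"
    unfolding cross_components comps x_def y_def a_def b_def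
    by (simp add: power2_eq_square algebra_simps)
  moreover have "dunchart z (\<i> * w) $ 2 + (unchart z \<times> dunchart z w) $ 2 = a * c * (2 - c * (x\<^sup>2 + y\<^sup>2 + 1))"
    unfolding cross_components comps x_def y_def a_def b_def
    by (simp add: power2_eq_square algebra_simps)
  moreover have "dunchart z (\<i> * w) $ 3 + (unchart z \<times> dunchart z w) $ 3 = 0"
    unfolding cross_components comps
    by (simp add: power2_eq_square algebra_simps)
  ultimately show "dunchart z (\<i> * w) = - (unchart z \<times> dunchart z w)"
    unfolding n by (simp add: vec3_eq_iff eq_neg_iff_add_eq_0)
qed

section \<open>The stabilizer of infinity consists of affine maps\<close>

context sharply_3_transitive_diff_group
begin

text \<open>The real derivative \<open>D\<close> in the coordinate commutes with multiplication by
  \<open>\<i>\<close>, by \<open>conformal\<close> and the quarter-turn rules for both charts; a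
  real-linear map with this property is multiplication by \<open>D 1\<close>.\<close>

lemma chart_map_holomorphic:
  assumes g: "g \<in> G" "g NP = NP"
  shows "(\<lambda>z. chart (rad_ext g (unchart z))) holomorphic_on UNIV"
proof -
  let ?f = "\<lambda>z. chart (rad_ext g (unchart z))"
  have "?f field_differentiable (at z)" for z
  proof -
    define p where "p = Abs_S2 (unchart z)"
    have p: "Rep_S2 p = unchart z" by (simp add: p_def Rep_Abs_S2)
    have "p \<noteq> NP" using p unchart_3_neq_1[of z] Rep_poles(3) by metis
    then have gp: "g p \<noteq> NP" using g apply_eq_iff[of g p NP] by simp
    define D where "D w = dchart (Rep_S2 (g p)) (Dm g p *v dunchart z w)" for w
    have "(rad_ext g \<circ> unchart has_derivative (\<lambda>v. Dm g p *v v) \<circ> dunchart z) (at z)"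
      by (rule diff_chain_at[OF unchart_has_derivative])
         (use g rad_ext_has_derivative[of g p] p in simp)
    then have "(chart \<circ> (rad_ext g \<circ> unchart) has_derivative
        dchart (Rep_S2 (g p)) \<circ> ((\<lambda>v. Dm g p *v v) \<circ> dunchart z)) (at z)"
      by (rule diff_chain_at) (use gp p rad_ext_Rep[of g p] ht_eq_1_iff in \<open>auto intro!: chart_has_derivative\<close>)
    then have D: "(?f has_derivative D) (at z)" unfolding D_def[abs_def] by (simp add: o_def)
    have "D (\<i> * w) = \<i> * D w" for w
    proof -
      have lin: "dchart x (- v) = - dchart x v" for x v
        by (simp add: dchart_def complex_eq_iff)
      have "(Dm g p *v dunchart z w) \<bullet> Rep_S2 (g p) = 0"
        using Dm_tangential[of g p "dunchart z w"] g by (simp add: p dunchart_tangential)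
      then have "dchart (Rep_S2 (g p)) (Rep_S2 (g p) \<times> (Dm g p *v dunchart z w)) = - \<i> * D w"
        using gp by (simp add: D_def dchart_cross ht_eq_1_iff)
      moreover have "Dm g p *v dunchart z (\<i> * w) = - (Rep_S2 (g p) \<times> (Dm g p *v dunchart z w))"
        unfolding dunchart_i p[symmetric] conformal[OF g(1), symmetric]
        by (simp add: vec3_eq_iff mat3_vec_components)
      ultimately show ?thesis unfolding D_def[of "\<i> * w"] by (simp add: lin)
    qed
    moreover have "linear D" using D by (rule has_derivative_linear)
    ultimately have "D w = D 1 * w" for w
    proof -
      have w: "w = Re w *\<^sub>R 1 + Im w *\<^sub>R (\<i> * 1)" by (simp add: complex_eq_iff)
      have "D w = Re w *\<^sub>R D 1 + Im w *\<^sub>R D (\<i> * 1)"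
        by (subst w) (simp only: linear_add[OF \<open>linear D\<close>] linear_scale[OF \<open>linear D\<close>])
      also have "\<dots> = D 1 * (Re w *\<^sub>R 1 + Im w *\<^sub>R (\<i> * 1))"
        unfolding \<open>\<And>w. D (\<i> * w) = \<i> * D w\<close> by (simp add: algebra_simps)
      also have "\<dots> = D 1 * w" using w by simp
      finally show ?thesis .
    qed
    then have eq: "D = (*) (D 1)" by (rule ext)
    have "(?f has_field_derivative D 1) (at z)"
      unfolding has_field_derivative_def eq[symmetric] by (rule D)
    then show ?thesis unfolding field_differentiable_def by blast
  qed
  then show ?thesis by (simp add: holomorphic_on_def)
qed

text \<open>Differentiability of \<open>inv g\<close> at \<open>NP\<close> gives a Lipschitz bound
  there. As the squared chordal distance to \<open>NP\<close> is
  \<open>4 / ((cmod z)\<^sup>2 + 1)\<close> in the coordinate, this bounds the modulus of the image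
  linearly. The exponent \<open>1\<close> is the degree expected by the polynomial Liouville
  theorem.\<close>

lemma chart_map_linear_growth:
  assumes g: "g \<in> G" "g NP = NP"
  obtains B where "\<And>z. cmod z \<ge> 1 \<Longrightarrow> cmod (chart (rad_ext g (unchart z))) \<le> B * cmod z ^ 1"
proof -
  have ig: "inv g \<in> G" "inv g NP = NP" using g by (auto intro: inv_fixes)
  obtain K where K: "K > 0" "\<And>v. norm (Dm (inv g) NP *v v) \<le> norm v * K"
    using bounded_linear.pos_bounded[OF matrix_vector_mul_bounded_linear[of "Dm (inv g) NP"]] by blast
  have "(rad_ext (inv g) has_derivative (\<lambda>v. Dm (inv g) NP *v v)) (at (Rep_S2 NP))"
    using ig by (simp add: rad_ext_has_derivative)
  then obtain d where d: "d > 0" "\<And>y. norm (y - Rep_S2 NP) < d \<Longrightarrow>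
      norm (rad_ext (inv g) y - Rep_S2 NP - Dm (inv g) NP *v (y - Rep_S2 NP)) \<le> 1 * norm (y - Rep_S2 NP)"
    unfolding has_derivative_at_alt using ig by (elim conjE allE[of _ 1]) auto
  \<comment> \<open>\<open>K + 1\<close> serves near the pole; away from it, chords have length at
    most 2, which is at most \<open>2 / d\<close> times a distance of at least
    \<open>d\<close>.\<close>
  define C where "C = max (K + 1) (2 / d)"
  have C: "C > 0" "K + 1 \<le> C" "2 / d \<le> C" using K by (auto simp: C_def)
  have lip: "norm (Rep_S2 (inv g q) - Rep_S2 NP) \<le> C * norm (Rep_S2 q - Rep_S2 NP)" for q
  proof (cases "norm (Rep_S2 q - Rep_S2 NP) < d")
    case True
    let ?y = "Rep_S2 q - Rep_S2 NP"
    have "norm (Rep_S2 (inv g q) - Rep_S2 NP) \<le>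
        norm (Rep_S2 (inv g q) - Rep_S2 NP - Dm (inv g) NP *v ?y) + norm (Dm (inv g) NP *v ?y)"
      using norm_triangle_ineq[of "Rep_S2 (inv g q) - Rep_S2 NP - Dm (inv g) NP *v ?y" "Dm (inv g) NP *v ?y"]
      by simp
    also have "\<dots> \<le> norm ?y + norm ?y * K"
      using d(2)[OF True] K(2)[of ?y] by simp
    also have "\<dots> = (K + 1) * norm ?y" by (simp add: algebra_simps)
    also have "\<dots> \<le> C * norm ?y" using C by (intro mult_right_mono) auto
    finally show ?thesis .
  next
    case False
    have "norm (Rep_S2 (inv g q) - Rep_S2 NP) \<le> norm (Rep_S2 (inv g q)) + norm (Rep_S2 NP)"
      by (rule norm_triangle_ineq4)
    also have "\<dots> = (2 / d) * d" using d(1) by simp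
    also have "\<dots> \<le> C * norm (Rep_S2 q - Rep_S2 NP)"
      using False C d(1) by (intro mult_mono) auto
    finally show ?thesis .
  qed
  have "cmod (chart (rad_ext g (unchart z))) \<le> (2 * C) * cmod z ^ 1" if z: "cmod z \<ge> 1" for z
  proof -
    define p where "p = Abs_S2 (unchart z)"
    have p: "Rep_S2 p = unchart z" by (simp add: p_def Rep_Abs_S2)
    have "p \<noteq> NP" using p unchart_3_neq_1[of z] Rep_poles(3) by metis
    then have gp: "g p \<noteq> NP" using g apply_eq_iff[of g p NP] by simp
    define w where "w = chart (rad_ext g (unchart z))"
    have w: "unchart w = Rep_S2 (g p)"
      unfolding w_def p[symmetric] rad_ext_Rep using gp by (simp add: unchart_chart ht_eq_1_iff)
    have h: "1 - unchart u $ 3 = 2 / ((cmod u)\<^sup>2 + 1)" for u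
      by (simp add: one_minus_unchart_3 cmod_power2)
    have "(norm (Rep_S2 p - Rep_S2 NP))\<^sup>2 \<le> (C * norm (Rep_S2 (g p) - Rep_S2 NP))\<^sup>2"
      using lip[of "g p"] g by (intro power_mono) auto
    then have "2 * (1 - ht p) \<le> C\<^sup>2 * (2 * (1 - ht (g p)))"
      unfolding power_mult_distrib norm_diff_NP .
    then have "4 * (1 / ((cmod z)\<^sup>2 + 1)) \<le> 4 * (C\<^sup>2 / ((cmod w)\<^sup>2 + 1))"
      unfolding p w[symmetric] h by (simp add: mult.commute)
    then have "1 / ((cmod z)\<^sup>2 + 1) \<le> C\<^sup>2 / ((cmod w)\<^sup>2 + 1)"
      by (rule mult_left_le_imp_le) simp
    moreover have "(cmod z)\<^sup>2 + 1 > 0" "(cmod w)\<^sup>2 + 1 > 0"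
      by (auto intro: add_nonneg_pos)
    ultimately have "(cmod w)\<^sup>2 + 1 \<le> C\<^sup>2 * ((cmod z)\<^sup>2 + 1)"
      by (simp add: divide_simps mult.commute)
    also have "\<dots> \<le> C\<^sup>2 * (4 * (cmod z)\<^sup>2)"
      using one_le_power[OF z, of 2] by (intro mult_left_mono) (linarith, simp)
    also have "\<dots> = (2 * C * cmod z)\<^sup>2" by (simp add: power_mult_distrib)
    finally have "(cmod w)\<^sup>2 \<le> (2 * C * cmod z)\<^sup>2" by linarith
    then have "cmod w \<le> 2 * C * cmod z" by (rule power2_le_imp_le) (use C in auto)
    then show ?thesis by (simp add: w_def)
  qed
  then show ?thesis by (rule that)
qed

text \<open>An entire function of linear growth is a polynomial of degree at most one; its slope is
  nonzero because \<open>SP\<close> and \<open>EP\<close> have different images.\<close>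

lemma stabilizer_affine:
  assumes g: "g \<in> G" "g NP = NP"
  obtains a b where "a \<noteq> 0" "\<And>p. stereo (Rep_S2 (g p)) = moeb a b 0 1 (stereo (Rep_S2 p))"
proof -
  define f where "f z = chart (rad_ext g (unchart z))" for z
  have hol: "f holomorphic_on UNIV" unfolding f_def using chart_map_holomorphic[OF g] .
  obtain B where B: "\<And>z. cmod z \<ge> 1 \<Longrightarrow> cmod (f z) \<le> B * cmod z ^ 1"
    unfolding f_def using chart_map_linear_growth[OF g] by blast
  define a b where "a = deriv f 0" and "b = f 0"
  have f: "f z = a * z + b" for z
    using Liouville_polynomial[OF hol B, where \<xi> = z] by (simp add: a_def b_def)
  have st: "stereo (Rep_S2 (g p)) = Some (f (chart (Rep_S2 p)))" if "p \<noteq> NP" for p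
  proof -
    have "g p \<noteq> NP" using g that apply_eq_iff[of g p NP] by simp
    then show ?thesis using that
      by (simp add: stereo_eq ht_eq_1_iff f_def unchart_chart)
  qed
  have "a \<noteq> 0"
  proof
    assume "a = 0"
    then have "stereo (Rep_S2 (g SP)) = stereo (Rep_S2 (g EP))" using st f by simp
    then have "Rep_S2 (g SP) = Rep_S2 (g EP)" using stereo_inv_stereo by metis
    then show False using g apply_eq_iff[of g SP EP] by (simp add: Rep_S2_eq_iff)
  qed
  moreover have "stereo (Rep_S2 (g p)) = moeb a b 0 1 (stereo (Rep_S2 p))" for p
  proof (cases "p = NP")
    case True
    then show ?thesis using g by (simp add: stereo_poles moeb_simps)
  next
    case False
    then show ?thesis unfolding st[OF False] by (simp add: f moeb_simps stereo_eq ht_eq_1_iff)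
  qed
  ultimately show ?thesis by (rule that)
qed

section \<open>Equality with the Moebius group\<close>

text \<open>An element moving \<open>NP\<close> is reduced to the stabilizer: some \<open>f\<close>
  fixing \<open>NP\<close> sends \<open>g NP\<close> to \<open>SP\<close>, and the half turn
  \<open>\<iota>\<close> sends \<open>SP\<close> back to \<open>NP\<close>. Thus \<open>g\<close> is
  an affine map, followed by \<open>1/z\<close>, followed by another affine map.\<close>

lemma subset_Moeb: "G \<subseteq> Moeb"
proof
  fix g assume g: "g \<in> G"
  show "g \<in> Moeb"
  proof (cases "g NP = NP")
    case True
    obtain a b where "a \<noteq> 0" "\<And>p. stereo (Rep_S2 (g p)) = moeb a b 0 1 (stereo (Rep_S2 p))"
      using stabilizer_affine[OF g True] by blast
    then show ?thesis by (intro MoebI[of a 1 b 0]) auto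
  next
    case False
    \<comment> \<open>The half turn about the first axis; it swaps the poles and reads
      \<open>1/z\<close> in the stereographic coordinate.\<close>
    define J :: "real^3^3" where "J = vector [vector [1, 0, 0], vector [0, -1, 0], vector [0, 0, -1]]"
    have J: "rotation_matrix J"
      unfolding rotation_matrix_def orthogonal_matrix
      by (simp add: J_def mat3_eq_iff mat3_mult_components mat_1_components transpose_def det_3)
    have Jv: "J *v x = vector [x$1, - x$2, - x$3]" for x
      by (simp add: J_def vec3_eq_iff mat3_vec_components)
    define \<iota> where "\<iota> = rot J"
    have \<iota>G: "\<iota> \<in> G" using J by (simp add: \<iota>_def)
    have R\<iota>: "Rep_S2 (\<iota> p) = vector [Rep_S2 p $ 1, - Rep_S2 p $ 2, - ht p]" for p
      using Rep_rot[OF J] by (simp add: \<iota>_def Jv)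
    have \<iota>\<iota>: "\<iota> (\<iota> p) = p" for p
    proof -
      have "Rep_S2 (\<iota> (\<iota> p)) = Rep_S2 p" by (simp add: R\<iota> vec3_eq_iff)
      then show ?thesis by (simp add: Rep_S2_eq_iff)
    qed
    have \<iota>SP: "\<iota> SP = NP"
    proof -
      have "Rep_S2 (\<iota> SP) = Rep_S2 NP" by (simp add: R\<iota> vec3_eq_iff)
      then show ?thesis by (simp add: Rep_S2_eq_iff)
    qed
    have st\<iota>: "stereo (Rep_S2 (\<iota> p)) = moeb 0 1 1 0 (stereo (Rep_S2 p))" for p
    proof -
      consider "p = NP" | "p = SP" | "p \<noteq> NP" "p \<noteq> SP" by blast
      then show ?thesis
      proof cases
        case 1
        then show ?thesis using \<iota>\<iota>[of SP] by (simp add: \<iota>SP stereo_poles moeb_simps)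
      next
        case 2
        then show ?thesis by (simp add: \<iota>SP stereo_poles moeb_simps)
      next
        case 3
        define x where "x = Rep_S2 p"
        have x: "x$3 \<noteq> 1" "x$3 \<noteq> -1" using 3 by (simp_all add: x_def ht_eq_1_iff ht_eq_minus_1_iff)
        have n: "(x$1)\<^sup>2 + (x$2)\<^sup>2 = (1 - x$3) * (1 + x$3)"
          using Rep_S2_components[of p] by (simp add: x_def power2_eq_square algebra_simps)
        have nz: "1 - x$3 \<noteq> 0" "1 + x$3 \<noteq> 0" using x by (auto simp: add_eq_0_iff)
        have "chart x * chart (Rep_S2 (\<iota> p)) =
            complex_of_real (((x$1)\<^sup>2 + (x$2)\<^sup>2) / ((1 - x$3) * (1 + x$3)))"
          by (simp add: R\<iota> x_def[symmetric] chart_def complex_eq_iff power2_eq_square add_divide_distrib)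
        then have one: "chart x * chart (Rep_S2 (\<iota> p)) = 1" unfolding n using nz by simp
        then have "chart x \<noteq> 0" by auto
        then have "chart (Rep_S2 (\<iota> p)) = 1 / chart x" using one by (simp add: field_simps)
        moreover have "Rep_S2 (\<iota> p) $ 3 \<noteq> 1" using x by (simp add: R\<iota> x_def[symmetric])
        ultimately show ?thesis
          using x \<open>chart x \<noteq> 0\<close> by (simp add: stereo_eq x_def[symmetric] moeb_simps)
      qed
    qed
    obtain f where f: "f \<in> G" "f NP = NP" "f (g NP) = SP"
      by (rule stabilizer_transitive[of NP "g NP" SP]) (use False in auto)
    have f': "inv f \<in> G" "inv f NP = NP" using f by (auto intro: inv_fixes)
    have h: "\<iota> \<circ> (f \<circ> g) \<in> G" "(\<iota> \<circ> (f \<circ> g)) NP = NP" using f g \<iota>G \<iota>SP by auto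
    obtain a b where ab: "a \<noteq> 0"
        "\<And>p. stereo (Rep_S2 ((\<iota> \<circ> (f \<circ> g)) p)) = moeb a b 0 1 (stereo (Rep_S2 p))"
      using stabilizer_affine[OF h] by blast
    obtain a' b' where ab': "a' \<noteq> 0"
        "\<And>p. stereo (Rep_S2 (inv f p)) = moeb a' b' 0 1 (stereo (Rep_S2 p))"
      using stabilizer_affine[OF f'] by blast
    \<comment> \<open>The coefficients are those of the corresponding product of three 2x2 matrices,
      with determinant \<open>- a * a'\<close>.\<close>
    have comp: "moeb a' b' 0 1 (moeb 0 1 1 0 (moeb a b 0 1 w)) = moeb (b' * a) (b' * b + a') a b w" for w
      using ab(1) by (cases w) (auto simp: moeb_simps field_simps)
    have "g p = inv f (\<iota> ((\<iota> \<circ> (f \<circ> g)) p))" for p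
      using f by (simp add: \<iota>\<iota>)
    then have "stereo (Rep_S2 (g p)) = moeb (b' * a) (b' * b + a') a b (stereo (Rep_S2 p))" for p
      using ab(2)[of p] ab'(2)[of "\<iota> ((\<iota> \<circ> (f \<circ> g)) p)"] st\<iota>[of "(\<iota> \<circ> (f \<circ> g)) p"] comp by simp
    moreover have "b' * a * b - (b' * b + a') * a \<noteq> 0"
      using ab(1) ab'(1) by (simp add: algebra_simps)
    ultimately show ?thesis by (intro MoebI[of "b' * a" b "b' * b + a'" a]) auto
  qed
qed

text \<open>By 3-transitivity some \<open>g\<close> in \<open>G\<close> agrees with \<open>m\<close>
  at three points. It is itself a Moebius map by \<open>subset_Moeb\<close>, and three values
  determine such a map.\<close>

lemma Moeb_subset: "Moeb \<subseteq> G"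
proof
  fix m assume "m \<in> Moeb"
  then obtain a b c d where det: "a * d - b * c = 1"
    and m: "\<And>p. stereo (Rep_S2 (m p)) = moeb a b c d (stereo (Rep_S2 p))"
    unfolding Moeb_iff by blast
  \<comment> \<open>Needed so that the three image points form an admissible triple for
    \<open>transitive_3\<close>.\<close>
  have inj: "p = q" if "m p = m q" for p q
  proof -
    have "stereo (Rep_S2 p) = stereo (Rep_S2 q)"
      using m[of p] m[of q] that moeb_inverse[OF det] by metis
    then show ?thesis by (metis stereo_inv_stereo Rep_S2_eq_iff)
  qed
  obtain g where g: "g \<in> G" "g NP = m NP" "g SP = m SP" "g EP = m EP"
    by (rule transitive_3[of NP SP EP "m NP" "m SP" "m EP"]) (use inj poles_distinct in blast)+
  then have "g \<in> Moeb" using subset_Moeb by blast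
  then obtain a' b' c' d' where det': "a' * d' - b' * c' = 1"
    and g': "\<And>p. stereo (Rep_S2 (g p)) = moeb a' b' c' d' (stereo (Rep_S2 p))"
    unfolding Moeb_iff by blast
  have "moeb a b c d = moeb a' b' c' d'"
    using m[of NP] m[of SP] m[of EP] g'[of NP] g'[of SP] g'[of EP] g
    by (intro moeb_eq_if_agree det det') (simp_all add: stereo_poles)
  then have "stereo (Rep_S2 (m p)) = stereo (Rep_S2 (g p))" for p using m g' by simp
  then have "m p = g p" for p by (metis stereo_inv_stereo Rep_S2_eq_iff)
  then have "m = g" ..
  then show "m \<in> G" using g by simp
qed

end

theorem theoremC:
  fixes G :: "(S2 \<Rightarrow> S2) set"
  assumes "is_group_of_maps G"
    and "G \<subseteq> Diff1plus"
    and "Rot \<subseteq> G"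
    and "sharply_three_transitive G"
  shows "G = Moeb"
proof -
  interpret sharply_3_transitive_diff_group G
    using assms by unfold_locales
  show ?thesis using subset_Moeb Moeb_subset by blast
qed

end
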